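(* For every fixed integer $d\ge 1$ there is a constant $C_d$ and an algorithm which, given an acyclic digraph $G$ with $n$ vertices, an integer $k$, and a set $I=\{(s_1,t_1),\dots,(s_k,t_k)\}$ of $k$ pairs of vertices of $G$, decides whether there exists a $(k-d)$-routing of $I$ in $G$ in time $O(n^{C_d})$, where $C_d=O(d)$ (in particular, the exponent does not depend on $k$).
   Context: Digraphs have no loops. A path in a digraph $G$ is a sequence $(v_1,\dots,v_\ell)$ of pairwise distinct vertices with $(v_i,v_{i+1})\in E(G)$ for all $1\le i<\ell$; it links $v_1$ to $v_\ell$. Given a digraph $G$, a set $I=\{(s_1,t_1),\dots,(s_k,t_k)\}$ of pairs of vertices and an integer $c$, a $c$-routing of $I$ is a set $\{P_1,\dots,P_k\}$ of paths such that $P_i$ links $s_i$ to $t_i$ for all $i$, and no vertex of $G$ lies on more than $c$ of the paths. The $(k,k-d)$-Congestion Routing problem asks, given $G$ and $k$ demand pairs, whether a $(k-d)$-routing of them exists. *)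

theory Defs
  imports "Graph_Theory.Graph_Theory" "HOL-Library.Landau_Symbols"
begin

section \<open>Routings with congestion\<close>

definition links :: "('a, 'b) pre_digraph \<Rightarrow> 'a list \<Rightarrow> 'a \<Rightarrow> 'a \<Rightarrow> bool" where
  "links G p s t \<longleftrightarrow> vpath p G \<and> hd p = s \<and> last p = t"

text \<open>
  The paths of a routing are indexed by the demand pairs. The congestion bound is an integer
  since it is instantiated with a difference that may be negative.
\<close>

definition is_routing ::
  "('a, 'b) pre_digraph \<Rightarrow> int \<Rightarrow> ('a \<times> 'a) set \<Rightarrow> ('a \<times> 'a \<Rightarrow> 'a list) \<Rightarrow> bool" where
  "is_routing G c I P \<longleftrightarrow>
     (\<forall>(s, t) \<in> I. links G (P (s, t)) s t) \<and>
     (\<forall>v \<in> verts G. int (card {i \<in> I. v \<in> set (P i)}) \<le> c)"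

definition has_routing :: "('a, 'b) pre_digraph \<Rightarrow> int \<Rightarrow> ('a \<times> 'a) set \<Rightarrow> bool" where
  "has_routing G c I \<longleftrightarrow> (\<exists>P. is_routing G c I P)"


section \<open>Random access machine\<close>

text \<open>
  Algorithms are structured RAM programs over registers and arrays of natural numbers (a program
  mentions only finitely many of each). Time is unit cost; the only arithmetic is addition and
  truncated subtraction, so that unit cost is polynomially related to Turing machine time
  (unit-cost multiplication would break this). Every expression node is charged one step, and so
  is every command node and every loop test.
\<close>

datatype exp =
    Const nat
  | Reg nat
  | Read nat exp  \<comment> \<open>array, index\<close>
  | Add exp exp
  | Sub exp exp

datatype com =
    Skip
  | Assign nat exp
  | Write nat exp exp  \<comment> \<open>array, index, value\<close>
  | Seq com com
  | Cond exp com com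
  | While exp com

record store =
  reg :: "nat \<Rightarrow> nat"
  arr :: "nat \<Rightarrow> nat \<Rightarrow> nat"

primrec val :: "exp \<Rightarrow> store \<Rightarrow> nat" where
  "val (Const m) \<sigma> = m"
| "val (Reg x) \<sigma> = reg \<sigma> x"
| "val (Read a e) \<sigma> = arr \<sigma> a (val e \<sigma>)"
| "val (Add e f) \<sigma> = val e \<sigma> + val f \<sigma>"
| "val (Sub e f) \<sigma> = val e \<sigma> - val f \<sigma>"

primrec cost :: "exp \<Rightarrow> nat" where
  "cost (Const m) = 1"
| "cost (Reg x) = 1"
| "cost (Read a e) = 1 + cost e"
| "cost (Add e f) = 1 + cost e + cost f"
| "cost (Sub e f) = 1 + cost e + cost f"

definition set_reg :: "nat \<Rightarrow> nat \<Rightarrow> store \<Rightarrow> store" where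
  "set_reg x m \<sigma> = \<sigma>\<lparr>reg := (reg \<sigma>)(x := m)\<rparr>"

definition set_arr :: "nat \<Rightarrow> nat \<Rightarrow> nat \<Rightarrow> store \<Rightarrow> store" where
  "set_arr a i m \<sigma> = \<sigma>\<lparr>arr := (arr \<sigma>)(a := (arr \<sigma> a)(i := m))\<rparr>"

text \<open>
  \<open>exec p \<sigma> n \<tau>\<close>: started in \<open>\<sigma>\<close>, the program \<open>p\<close> halts in \<open>\<tau>\<close> after exactly \<open>n\<close> steps.
  A guard counts as true iff its value is nonzero.
\<close>

inductive exec :: "com \<Rightarrow> store \<Rightarrow> nat \<Rightarrow> store \<Rightarrow> bool" where
  Skip: "exec Skip \<sigma> 1 \<sigma>"
| Assign: "exec (Assign x e) \<sigma> (1 + cost e) (set_reg x (val e \<sigma>) \<sigma>)"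
| Write: "exec (Write a e f) \<sigma> (1 + cost e + cost f) (set_arr a (val e \<sigma>) (val f \<sigma>) \<sigma>)"
| Seq: "exec p \<sigma> m \<tau> \<Longrightarrow> exec q \<tau> n \<rho> \<Longrightarrow> exec (Seq p q) \<sigma> (1 + m + n) \<rho>"
| CondTrue: "val e \<sigma> \<noteq> 0 \<Longrightarrow> exec p \<sigma> n \<tau> \<Longrightarrow> exec (Cond e p q) \<sigma> (1 + cost e + n) \<tau>"
| CondFalse: "val e \<sigma> = 0 \<Longrightarrow> exec q \<sigma> n \<tau> \<Longrightarrow> exec (Cond e p q) \<sigma> (1 + cost e + n) \<tau>"
| WhileFalse: "val e \<sigma> = 0 \<Longrightarrow> exec (While e p) \<sigma> (1 + cost e) \<sigma>"
| WhileTrue: "val e \<sigma> \<noteq> 0 \<Longrightarrow> exec p \<sigma> m \<tau> \<Longrightarrow> exec (While e p) \<tau> n \<rho> \<Longrightarrow>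
    exec (While e p) \<sigma> (1 + cost e + m + n) \<rho>"

inductive_cases exec_SkipE: "exec Skip \<sigma> n \<tau>"
inductive_cases exec_AssignE: "exec (Assign x e) \<sigma> n \<tau>"
inductive_cases exec_WriteE: "exec (Write a e f) \<sigma> n \<tau>"
inductive_cases exec_SeqE: "exec (Seq p q) \<sigma> n \<tau>"
inductive_cases exec_CondE: "exec (Cond e p q) \<sigma> n \<tau>"
inductive_cases exec_WhileE: "exec (While e p) \<sigma> n \<tau>"

lemma exec_deterministic:
  assumes "exec p \<sigma> n \<tau>" and "exec p \<sigma> n' \<tau>'"
  shows "n' = n \<and> \<tau>' = \<tau>"
  using assms
proof (induction arbitrary: n' \<tau>' rule: exec.induct)
  case (Seq p \<sigma> m \<tau> q n \<rho>)
  from Seq.prems obtain m' \<tau>1 n1 where "exec p \<sigma> m' \<tau>1" "exec q \<tau>1 n1 \<tau>'" "n' = Suc (m' + n1)"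
    by (rule exec_SeqE)
  with Seq.IH(1)[of m' \<tau>1] Seq.IH(2)[of n1 \<tau>'] show ?case by simp
next
  case (CondTrue e \<sigma> p n \<tau> q)
  from CondTrue.prems CondTrue.hyps obtain n1 where "exec p \<sigma> n1 \<tau>'" "n' = Suc (cost e + n1)"
    by (elim exec_CondE) auto
  with CondTrue.IH[of n1 \<tau>'] show ?case by simp
next
  case (CondFalse e \<sigma> q n \<tau> p)
  from CondFalse.prems CondFalse.hyps obtain n1 where "exec q \<sigma> n1 \<tau>'" "n' = Suc (cost e + n1)"
    by (elim exec_CondE) auto
  with CondFalse.IH[of n1 \<tau>'] show ?case by simp
next
  case (WhileFalse e \<sigma> p)
  from WhileFalse.prems show ?case
    by (rule exec_WhileE) (use WhileFalse.hyps in simp_all)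
next
  case (WhileTrue e \<sigma> p m \<tau> n \<rho>)
  from WhileTrue.prems obtain m' \<tau>1 n1
    where "exec p \<sigma> m' \<tau>1" "exec (While e p) \<tau>1 n1 \<tau>'" "n' = Suc (cost e + m' + n1)"
    by (rule exec_WhileE) (use WhileTrue.hyps in auto)
  with WhileTrue.IH(1)[of m' \<tau>1] WhileTrue.IH(2)[of n1 \<tau>'] show ?case by simp
qed (elim exec_SkipE exec_AssignE exec_WriteE; simp)+


section \<open>Encoding of instances and answers\<close>

text \<open>
  The vertices of an input digraph with \<open>n\<close> vertices are \<open>0, \<dots>, n - 1\<close>. Register 0 holds \<open>n\<close>,
  register 1 the number of demand pairs, array 0 the adjacency matrix in row-major order, and
  arrays 1 and 2 the sources and the targets of the demand pairs. Everything else is zero.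
\<close>

definition input :: "nat pair_pre_digraph \<Rightarrow> (nat \<times> nat) list \<Rightarrow> store" where
  "input G ps =
     (let n = card (pverts G); k = length ps in
      \<lparr>reg = (\<lambda>_. 0)(0 := n, 1 := k),
       arr = (\<lambda>_ _. 0)
         (0 := (\<lambda>j. if j < n * n \<and> (j div n, j mod n) \<in> parcs G then 1 else 0),
          1 := (\<lambda>i. if i < k then fst (ps ! i) else 0),
          2 := (\<lambda>i. if i < k then snd (ps ! i) else 0))\<rparr>)"

definition accepting :: "store \<Rightarrow> bool" where
  "accepting \<sigma> \<longleftrightarrow> reg \<sigma> 0 \<noteq> 0"

text \<open>
  The demand pairs form a set, so the list presenting them has no repetitions. The digraph may
  have no vertices.
\<close>

definition acyclic_instance :: "nat pair_pre_digraph \<Rightarrow> (nat \<times> nat) list \<Rightarrow> bool" where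
  "acyclic_instance G ps \<longleftrightarrow>
     pair_digraph G \<and> acyclic (parcs G) \<and> pverts G = {..<card (pverts G)} \<and>
     distinct ps \<and> set ps \<subseteq> pverts G \<times> pverts G"

text \<open>
  On every acyclic instance with \<open>n\<close> vertices and \<open>k\<close> demand pairs, the program halts within
  \<open>T n\<close> steps and accepts iff there is a \<open>(k - d)\<close>-routing.
\<close>

definition decides_routing_within :: "nat \<Rightarrow> com \<Rightarrow> (nat \<Rightarrow> nat) \<Rightarrow> bool" where
  "decides_routing_within d p T \<longleftrightarrow>
     (\<forall>G ps. acyclic_instance G ps \<longrightarrow>
       (\<exists>m \<tau>. exec p (input G ps) m \<tau> \<and> m \<le> T (card (pverts G)) \<and>
         (accepting \<tau> \<longleftrightarrow> has_routing (with_proj G) (int (length ps) - int d) (set ps))))"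

end

theory Submission
  imports Defs
begin

text \<open>
  In a \<open>(k - d)\<close>-routing every vertex is avoided by at least \<open>d\<close> of the paths, and this property is
  inherited upwards: if the members of a subset of the pairs have paths such that every vertex is
  avoided by \<open>d\<close> of them, the remaining pairs may be linked arbitrarily. Conversely, in an acyclic
  digraph some pair can be discarded from a routing of more than \<open>3d\<close> pairs after rerouting. So it
  suffices to test linkability of each pair and to find at most \<open>3d\<close> pairs with the required
  routing. The latter is a pebble game on tuples of vertices, whose winning positions, stored
  together with the targets of the pebbles, are computed by saturation of a table of size
  \<open>(n + 1) ^ (6d)\<close>. Reachability is the game with one pebble.
\<close>

section \<open>Discarding demand pairs\<close>

text \<open>The exponent arises as follows. With \<open>m\<close> pebbles a position has
  \<open>m\<close> vertices and \<open>m\<close> targets; a sweep of the table also tries a goal for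
  one move, and \<open>m * n + 1\<close> sweeps suffice. One game thus costs of the order of
  \<open>(n + 2) ^ (2 * m + 2)\<close>, and \<open>m\<close> is at most \<open>3 * d\<close>.
  Storing the targets lets a single table serve every choice of \<open>m\<close> pairs: choosing the
  pairs afterwards costs \<open>k ^ m\<close> lookups up to a constant, and \<open>k\<close> is at
  most \<open>n * n\<close> because the pairs are distinct, so \<open>k\<close> never enters the
  exponent. The factor 3 in \<open>3 * d\<close> is the number of vertices that an exchange must
  find on one path: the two ends of a segment and a vertex to be gained. Acyclicity is used twice:
  recombined walks are again paths, and the pebbles can be moved in an order in which a vertex is
  left only when nobody can arrive there any more.\<close>

lemma finite_attains_max:
  fixes f :: "'a \<Rightarrow> nat"
  assumes "finite S" "S \<noteq> {}"
  obtains x where "x \<in> S" "\<And>y. y \<in> S \<Longrightarrow> f y \<le> f x"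
proof -
  have "Max (f ` S) \<in> f ` S" using assms by (intro Max_in) auto
  then obtain x where "x \<in> S" "f x = Max (f ` S)" by auto
  then show thesis using that Max_ge[of "f ` S"] assms by simp
qed

lemma finite_attains_min:
  fixes f :: "'a \<Rightarrow> nat"
  assumes "finite S" "S \<noteq> {}"
  obtains x where "x \<in> S" "\<And>y. y \<in> S \<Longrightarrow> f x \<le> f y"
proof -
  have "Min (f ` S) \<in> f ` S" using assms by (intro Min_in) auto
  then obtain x where "x \<in> S" "f x = Min (f ` S)" by auto
  then show thesis using that Min_le[of "f ` S"] assms by simp
qed

section \<open>Paths and heights in acyclic digraphs\<close>

locale acyclic_pair_digraph = pair_digraph +
  assumes acyclic_arcs: "acyclic (parcs G)"
begin

text \<open>Walks suffice: acyclicity makes their vertices distinct, and a walk that starts in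
  \<open>pverts G\<close> stays there (\<open>links_iff\<close>). Recombining pieces of paths
  therefore requires no check of distinctness.\<close>

definition path :: "'a list \<Rightarrow> bool" where
  "path p \<longleftrightarrow> p \<noteq> [] \<and> successively (\<lambda>u v. (u, v) \<in> parcs G) p"

text \<open>Reachability dictates the order in which a path visits its vertices, so all paths meet
  their common vertices in the same order.\<close>

lemma path_sorted:
  assumes "path p"
  shows "sorted_wrt (\<lambda>u v. (u, v) \<in> (parcs G)\<^sup>+) p"
proof -
  have "successively (\<lambda>u v. (u, v) \<in> (parcs G)\<^sup>+) p"
    by (rule successively_mono[of "\<lambda>u v. (u, v) \<in> parcs G"]) (use assms in \<open>auto simp: path_def\<close>)
  then show ?thesis
    by (subst (asm) successively_conv_sorted_wrt) (auto intro: transpI trancl_trans)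
qed

lemma irrefl_reach: "(v, v) \<notin> (parcs G)\<^sup>+"
  using acyclic_arcs by (simp add: acyclic_def)

lemma path_distinct: "path p \<Longrightarrow> distinct p"
  by (drule path_sorted) (induction p, auto simp: irrefl_reach)

lemma set_vwalk_arcs_subset:
  "set (vwalk_arcs p) \<subseteq> E \<longleftrightarrow> successively (\<lambda>u v. (u, v) \<in> E) p"
  by (induction p rule: vwalk_arcs.induct) auto

lemma path_in_verts:
  assumes "path p" "hd p \<in> pverts G"
  shows "set p \<subseteq> pverts G"
  using assms
proof (induction p)
  case (Cons v p)
  then show ?case
    using arc_snd_in_verts by (cases p) (fastforce simp: path_def)+
qed (simp add: path_def)

lemma links_iff:
  assumes "s \<in> pverts G"
  shows "links (with_proj G) p s t \<longleftrightarrow> path p \<and> hd p = s \<and> last p = t"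
  using assms path_in_verts[of p] path_distinct[of p]
  by (auto simp: links_def vpath_def vwalk_def set_vwalk_arcs_subset path_def)

text \<open>As \<open>w\<close> cannot reach \<open>u\<close>, every path through both meets
  \<open>u\<close> first. Two such paths can thus exchange their segments between \<open>u\<close>
  and \<open>w\<close>.\<close>

lemma path_split2:
  assumes "path p" "u \<in> set p" "w \<in> set p" "(w, u) \<notin> (parcs G)\<^sup>*"
  obtains p1 p2 p3 where "p = p1 @ u # p2 @ w # p3"
proof -
  obtain p1 q where p: "p = p1 @ u # q" using assms(2) by (meson split_list)
  have "w \<notin> set p1"
    using path_sorted[OF assms(1)] assms(4) unfolding p by (auto simp: sorted_wrt_append dest: trancl_into_rtrancl)
  moreover have "w \<noteq> u" using assms(4) by auto
  ultimately have "w \<in> set q" using assms(3) p by auto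
  then obtain p2 p3 where "q = p2 @ w # p3" by (meson split_list)
  with p that show thesis by blast
qed

text \<open>A numerical substitute for a topological order: it increases strictly along arcs, so
  first and last vertices can be chosen by minimum and maximum.\<close>

definition height :: "'a \<Rightarrow> nat" where
  "height v = card {u. (u, v) \<in> (parcs G)\<^sup>+}"

lemma finite_reach: "finite {u. (u, v) \<in> (parcs G)\<^sup>+}"
  by (rule finite_subset[of _ "Domain ((parcs G)\<^sup>+)"]) (auto intro: pair_finite_arcs finite_Domain DomainI simp del: trancl_domain)

lemma height_less:
  assumes "(u, v) \<in> (parcs G)\<^sup>+"
  shows "height u < height v"
  unfolding height_def
  by (rule psubset_card_mono[OF finite_reach]) (use assms irrefl_reach[of u] in auto)

lemma path_comparable:
  assumes "path p" "u \<in> set p" "v \<in> set p" "u \<noteq> v"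
  shows "(u, v) \<in> (parcs G)\<^sup>+ \<or> (v, u) \<in> (parcs G)\<^sup>+"
proof -
  obtain i j where "i < length p" "j < length p" "p ! i = u" "p ! j = v"
    using assms by (auto simp: in_set_conv_nth)
  then show ?thesis
    using path_sorted[OF assms(1)] assms(4) by (cases i j rule: linorder_cases) (auto simp: sorted_wrt_iff_nth_less)
qed

text \<open>Heights increase strictly along a path, so the position of a vertex relative to
  \<open>u\<close> and \<open>w\<close> can be read off its height.\<close>

lemma path_between:
  assumes "path (p1 @ u # p2 @ w # p3)" "x \<in> set (p1 @ u # p2 @ w # p3)"
    and "height u < height x" "height x < height w"
  shows "x \<in> set p2"
proof -
  have s: "sorted_wrt (\<lambda>u v. (u, v) \<in> (parcs G)\<^sup>+) (p1 @ u # p2 @ w # p3)"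
    using path_sorted[OF assms(1)] .
  have "x \<notin> set p1" "x \<noteq> u" "x \<noteq> w" "x \<notin> set p3"
    using s assms(3,4) by (fastforce simp: sorted_wrt_append dest: height_less)+
  then show ?thesis using assms(2) by auto
qed

lemma path_betweenD:
  assumes "path (p1 @ u # p2 @ w # p3)" "x \<in> set p2"
  shows "height u < height x" "height x < height w"
  using path_sorted[OF assms(1)] assms(2) by (auto simp: sorted_wrt_append height_less)

section \<open>Loads of vertices\<close>

definition connects :: "'a \<times> 'a \<Rightarrow> 'a list \<Rightarrow> bool" where
  "connects i p \<longleftrightarrow> path p \<and> hd p = fst i \<and> last p = snd i"

text \<open>Counting occurrences makes the load depend only on the multiset of all visited vertices,
  so an exchange of segments preserves it (\<open>load_swap\<close>). As paths repeat no vertex, it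
  is the number of paths through \<open>v\<close> (\<open>load_eq_card\<close>).\<close>

definition load :: "('a \<times> 'a) set \<Rightarrow> ('a \<times> 'a \<Rightarrow> 'a list) \<Rightarrow> 'a \<Rightarrow> nat" where
  "load I P v = (\<Sum>i\<in>I. count_list (P i) v)"

lemma load_eq_card:
  assumes "finite I" "\<And>i. i \<in> I \<Longrightarrow> connects i (P i)"
  shows "load I P v = card {i \<in> I. v \<in> set (P i)}"
proof -
  have "count_list (P i) v = (if v \<in> set (P i) then 1 else 0)" if "i \<in> I" for i
  proof (cases "v \<in> set (P i)")
    case True
    then obtain q r where qr: "P i = q @ v # r" by (meson split_list)
    have "distinct (P i)" using assms(2)[OF that] path_distinct by (auto simp: connects_def)
    with qr show ?thesis by (auto simp: count_list_0_iff)
  qed (simp add: count_list_0_iff)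
  then have "load I P v = (\<Sum>i\<in>I. if v \<in> set (P i) then 1 else 0)"
    unfolding load_def by (intro sum.cong) auto
  also have "\<dots> = card {i \<in> I. v \<in> set (P i)}"
    using assms(1) by (simp add: sum.If_cases Collect_conj_eq)
  finally show ?thesis .
qed

lemma is_routing_iff:
  assumes "finite I" "I \<subseteq> pverts G \<times> pverts G"
  shows "is_routing (with_proj G) c I P \<longleftrightarrow>
    (\<forall>i\<in>I. connects i (P i)) \<and> (\<forall>v\<in>pverts G. int (load I P v) \<le> c)"
proof -
  have 1: "(\<forall>(s, t) \<in> I. links (with_proj G) (P (s, t)) s t) \<longleftrightarrow> (\<forall>i\<in>I. connects i (P i))"
    using assms(2) by (intro ball_cong refl) (auto simp: links_iff connects_def)
  show ?thesis
    unfolding is_routing_def 1 using load_eq_card[OF assms(1)] by auto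
qed

lemma load_swap:
  assumes "finite I" "i \<in> I" "j \<in> I" "i \<noteq> j"
    and "mset p + mset q = mset (P i) + mset (P j)"
  shows "load I (P(i := p, j := q)) v = load I P v"
proof -
  have I: "I = insert i (insert j (I - {i, j}))" using assms by auto
  have "load (I - {i, j}) (P(i := p, j := q)) v = load (I - {i, j}) P v"
    unfolding load_def by (intro sum.cong) auto
  moreover have "count_list p v + count_list q v = count_list (P i) v + count_list (P j) v"
    using arg_cong[OF assms(5), of "\<lambda>M. count M v"] by (simp add: count_mset)
  moreover have "load I Q v = count_list (Q i) v + (count_list (Q j) v + load (I - {i, j}) Q v)" for Q
    unfolding load_def using assms(1,4) by (subst I) simp
  ultimately show ?thesis using assms(4) by simp
qed

text \<open>
  A vertex is critical if exactly \<open>d\<close> of the paths avoid it. As there are more than \<open>3d\<close> paths, any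
  three critical vertices lie on a common path. Hence a path through the first and the last critical
  vertex that misses some critical vertex \<open>v\<close> can exchange the segment around \<open>v\<close> with a path
  containing \<open>v\<close> and the two ends of the segment; this does not change the load of any vertex. A
  path through all critical vertices can be discarded.
\<close>

lemma discard_pair:
  assumes fin: "finite I" and sub: "I \<subseteq> pverts G \<times> pverts G" and big: "3 * d < card I"
    and rout: "has_routing (with_proj G) (int (card I) - int d) I"
  obtains i where "i \<in> I" "has_routing (with_proj G) (int (card (I - {i})) - int d) (I - {i})"
proof -
  obtain P0 where "is_routing (with_proj G) (int (card I) - int d) I P0"
    using rout by (auto simp: has_routing_def)
  then have P0: "\<And>i. i \<in> I \<Longrightarrow> connects i (P0 i)"
    and load0: "\<And>v. v \<in> pverts G \<Longrightarrow> load I P0 v + d \<le> card I"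
    using is_routing_iff[OF fin sub] by fastforce+
  define K where "K = {v \<in> pverts G. load I P0 v + d = card I}"
  have finK: "finite K" unfolding K_def using pair_finite_verts by auto
  \<comment> \<open>Equal loads at every vertex keep the set \<open>K\<close> of critical vertices
    the same for all members of \<open>F\<close>.\<close>
  define F where "F = {Q. (\<forall>i\<in>I. connects i (Q i)) \<and> (\<forall>v. load I Q v = load I P0 v)}"
  have P0F: "P0 \<in> F" using P0 by (auto simp: F_def)
  have avoid: "card {i \<in> I. v \<notin> set (Q i)} = d" if "Q \<in> F" "v \<in> K" for Q v
  proof -
    have "load I Q v = card {i \<in> I. v \<in> set (Q i)}"
      using that(1) by (intro load_eq_card fin) (auto simp: F_def)
    moreover have "load I Q v + d = card I" using that by (auto simp: F_def K_def)
    moreover have "card I = card {i \<in> I. v \<in> set (Q i)} + card {i \<in> I. v \<notin> set (Q i)}"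
      using fin by (subst card_Un_disjoint[symmetric]) (auto intro!: arg_cong[of _ _ card])
    ultimately show ?thesis by simp
  qed
  have common: "\<exists>j\<in>I. u \<in> set (Q j) \<and> v \<in> set (Q j) \<and> w \<in> set (Q j)"
    if Q: "Q \<in> F" and K: "u \<in> K" "v \<in> K" "w \<in> K" for Q u v w
  proof (rule ccontr)
    let ?N = "\<lambda>x. {i \<in> I. x \<notin> set (Q i)}"
    assume "\<not> ?thesis"
    then have "I \<subseteq> ?N u \<union> (?N v \<union> ?N w)" by auto
    then have "card I \<le> card (?N u \<union> (?N v \<union> ?N w))" using fin by (intro card_mono) auto
    also have "\<dots> \<le> card (?N u) + (card (?N v) + card (?N w))"
      by (meson card_Un_le add_left_mono order_trans)
    also have "\<dots> = 3 * d" using avoid[OF Q] K by simp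
    finally show False using big by simp
  qed
  \<comment> \<open>Vertices of equal height may exist, but two critical ones share a path and are
    therefore comparable.\<close>
  have inj: "height u \<noteq> height v" if uv: "u \<in> K" "v \<in> K" "u \<noteq> v" for u v
  proof -
    obtain j where "j \<in> I" "u \<in> set (P0 j)" "v \<in> set (P0 j)"
      using common[OF P0F uv(1) uv(2) uv(2)] by auto
    then show ?thesis
      using path_comparable[of "P0 j" u v] P0[of j] uv(3) by (auto simp: connects_def dest: height_less)
  qed
  have less: "(w, u) \<notin> (parcs G)\<^sup>*" if "height u < height w" for u w
    using that height_less[of w u] by (auto simp: rtrancl_eq_or_trancl)
  have "\<exists>Q\<in>F. \<exists>i\<in>I. K \<subseteq> set (Q i)"
  proof (cases "K = {}")
    case True
    have "I \<noteq> {}" using big by auto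
    then show ?thesis using True P0F by auto
  next
    case False
    obtain a where a: "a \<in> K" "\<And>x. x \<in> K \<Longrightarrow> height a \<le> height x"
      using finite_attains_min[OF finK False, of height] by blast
    obtain b where b: "b \<in> K" "\<And>x. x \<in> K \<Longrightarrow> height x \<le> height b"
      using finite_attains_max[OF finK False, of height] by blast
    obtain i where i: "i \<in> I" "a \<in> set (P0 i)" "b \<in> set (P0 i)"
      using common[OF P0F a(1) a(1)] b by blast
    \<comment> \<open>Keeping both extremes \<open>a\<close> and \<open>b\<close> on path
      \<open>i\<close> ensures that a critical vertex missed by this path has critical vertices of
      the path below and above it.\<close>
    define good where "good Q \<longleftrightarrow> Q \<in> F \<and> a \<in> set (Q i) \<and> b \<in> set (Q i)" for Q
    have "\<exists>Q. good Q \<and> (\<forall>Q'. good Q' \<longrightarrow> card (K \<inter> set (Q' i)) \<le> card (K \<inter> set (Q i)))"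
      by (rule ex_has_greatest_nat[where k = P0 and b = "Suc (card K)"])
        (use i P0F finK in \<open>auto simp: good_def less_Suc_eq_le intro: card_mono\<close>)
    then obtain Q where Q: "good Q" and max: "\<And>Q'. good Q' \<Longrightarrow> card (K \<inter> set (Q' i)) \<le> card (K \<inter> set (Q i))"
      by blast
    have QF: "Q \<in> F" using Q by (simp add: good_def)
    have "K \<subseteq> set (Q i)"
    proof (rule ccontr)
      assume "\<not> K \<subseteq> set (Q i)"
      then obtain v where v: "v \<in> K" "v \<notin> set (Q i)" by auto
      have av: "height a < height v" and vb: "height v < height b"
        using a b v Q inj[of a v] inj[of v b] by (force simp: good_def le_less)+
      \<comment> \<open>The ends \<open>u\<close> and \<open>w\<close> are chosen as the critical
        vertices of \<open>Q i\<close> nearest to \<open>v\<close> on either side. The segment given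
        away then contains no critical vertex, so path \<open>i\<close> gains \<open>v\<close> and
        loses none, against its maximality.\<close>
      define L where "L = {x \<in> K \<inter> set (Q i). height x < height v}"
      define R where "R = {x \<in> K \<inter> set (Q i). height v < height x}"
      have finLR: "finite L" "finite R" using finK by (auto simp: L_def R_def)
      have ne: "L \<noteq> {}" "R \<noteq> {}" using a b av vb Q by (auto simp: L_def R_def good_def)
      obtain u where u: "u \<in> L" "\<And>x. x \<in> L \<Longrightarrow> height x \<le> height u"
        using finite_attains_max[OF finLR(1) ne(1), of height] by blast
      obtain w where w: "w \<in> R" "\<And>x. x \<in> R \<Longrightarrow> height w \<le> height x"
        using finite_attains_min[OF finLR(2) ne(2), of height] by blast
      have uw: "height u < height w" "height u < height v" "height v < height w"
        using u(1) w(1) by (auto simp: L_def R_def)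
      obtain j where j: "j \<in> I" "u \<in> set (Q j)" "v \<in> set (Q j)" "w \<in> set (Q j)"
        using common[OF QF, of u v w] u(1) v(1) w(1) by (auto simp: L_def R_def)
      have ij: "i \<noteq> j" using v j by auto
      have pi: "path (Q i)" and pj: "path (Q j)"
        using QF i j by (auto simp: F_def connects_def)
      obtain p1 p2 p3 where p: "Q i = p1 @ u # p2 @ w # p3"
        using path_split2[OF pi _ _ less[OF uw(1)]] u(1) w(1) by (auto simp: L_def R_def)
      obtain q1 q2 q3 where q: "Q j = q1 @ u # q2 @ w # q3"
        using path_split2[OF pj j(2,4) less[OF uw(1)]] by auto
      define Q' where "Q' = Q(i := p1 @ u # q2 @ w # p3, j := q1 @ u # p2 @ w # q3)"
      have "path (p1 @ u # q2 @ w # p3)" "path (q1 @ u # p2 @ w # q3)"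
        using pi pj unfolding p q
        by (auto simp: path_def successively_append_iff successively_Cons hd_append split: if_splits)
      moreover have "hd (p1 @ u # q2 @ w # p3) = hd (Q i)" "last (p1 @ u # q2 @ w # p3) = last (Q i)"
        "hd (q1 @ u # p2 @ w # q3) = hd (Q j)" "last (q1 @ u # p2 @ w # q3) = last (Q j)"
        unfolding p q by (auto simp: hd_append)
      ultimately have "\<forall>k\<in>I. connects k (Q' k)"
        using QF i(1) j(1) by (auto simp: Q'_def F_def connects_def)
      moreover have "load I Q' x = load I Q x" for x
        unfolding Q'_def by (rule load_swap) (use fin i j ij p q in auto)
      ultimately have Q'F: "Q' \<in> F" using QF by (auto simp: F_def)
      have disj: "x \<notin> K" if "x \<in> set p2" for x
      proof
        assume xK: "x \<in> K"
        have x: "height u < height x" "height x < height w" "x \<in> set (Q i)"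
          using path_betweenD[OF pi[unfolded p] that] that p by auto
        have "x \<noteq> v" using x(3) v(2) by auto
        then have "x \<in> L \<or> x \<in> R" using inj[OF xK v(1)] x(3) xK by (auto simp: L_def R_def)
        then show False using u(2)[of x] w(2)[of x] x by auto
      qed
      have "v \<in> set q2" using path_between[OF pj[unfolded q]] j(3) uw q by auto
      then have sub: "insert v (K \<inter> set (Q i)) \<subseteq> K \<inter> set (Q' i)"
        using disj v(1) p ij by (auto simp: Q'_def)
      have "card (K \<inter> set (Q i)) < card (insert v (K \<inter> set (Q i)))"
        using v(2) finK by simp
      also have "\<dots> \<le> card (K \<inter> set (Q' i))" using sub finK by (intro card_mono) auto
      finally have "card (K \<inter> set (Q i)) < card (K \<inter> set (Q' i))" .
      moreover have "good Q'"
        using Q'F a(1) b sub Q by (auto simp: good_def)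
      ultimately show False using max[of Q'] by simp
    qed
    then show ?thesis using QF i(1) by blast
  qed
  then obtain Q i where Q: "Q \<in> F" "i \<in> I" "K \<subseteq> set (Q i)" by blast
  \<comment> \<open>Discarding a path lowers the bound by one. At a critical vertex the load drops
    as well, and at every other vertex the old bound was not attained.\<close>
  have "load (I - {i}) Q v + d \<le> card (I - {i})" if v: "v \<in> pverts G" for v
  proof -
    have 1: "load I Q v = count_list (Q i) v + load (I - {i}) Q v"
      unfolding load_def using fin Q(2) by (subst sum.remove[of I i]) auto
    have 2: "load I Q v = load I P0 v" using Q(1) by (auto simp: F_def)
    have 3: "card I = Suc (card (I - {i}))" using fin Q(2) by (metis card.remove)
    show ?thesis
    proof (cases "v \<in> K")
      case True
      then have "0 < count_list (Q i) v" using Q(3) by (metis count_list_0_iff gr0I subsetD)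
      then show ?thesis using 1 2 3 load0[OF v] by simp
    next
      case False
      then have "load I P0 v + d < card I" using load0[OF v] v by (auto simp: K_def le_less)
      then show ?thesis using 1 2 3 by simp
    qed
  qed
  then have "is_routing (with_proj G) (int (card (I - {i})) - int d) (I - {i}) Q"
    using is_routing_iff[of "I - {i}"] fin sub Q(1) by (force simp: F_def)
  then show thesis using that[OF Q(2)] unfolding has_routing_def by blast
qed

lemma small_subset_routing:
  assumes "finite I" "I \<subseteq> pverts G \<times> pverts G" "has_routing (with_proj G) (int (card I) - int d) I"
  obtains J where "J \<subseteq> I" "card J \<le> 3 * d" "has_routing (with_proj G) (int (card J) - int d) J"
  using assms
proof (induction "card I" arbitrary: I thesis)
  case 0
  then show ?case by force
next
  case (Suc k)
  show ?case
  proof (cases "3 * d < card I")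
    case True
    obtain i where i: "i \<in> I" "has_routing (with_proj G) (int (card (I - {i})) - int d) (I - {i})"
      using discard_pair[OF Suc.prems(2,3) True Suc.prems(4)] .
    have k: "k = card (I - {i})" using Suc.hyps(2) Suc.prems(2) i(1) by simp
    obtain J where "J \<subseteq> I - {i}" "card J \<le> 3 * d" "has_routing (with_proj G) (int (card J) - int d) J"
      using Suc.hyps(1)[OF k _ _ _ i(2)] Suc.prems(2,3) by blast
    then show ?thesis using Suc.prems(1) by blast
  next
    case False
    then show ?thesis using Suc.prems(1,4) by force
  qed
qed

text \<open>Each additional path raises the load of a vertex by at most one and the bound by exactly
  one.\<close>

lemma extend_routing:
  assumes fin: "finite I" and sub: "I \<subseteq> pverts G \<times> pverts G" and JI: "J \<subseteq> I"
    and rout: "has_routing (with_proj G) (int (card J) - int d) J"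
    and linkable: "\<And>i. i \<in> I \<Longrightarrow> \<exists>p. connects i p"
  shows "has_routing (with_proj G) (int (card I) - int d) I"
proof -
  have finJ: "finite J" using fin JI finite_subset by auto
  obtain P where P: "is_routing (with_proj G) (int (card J) - int d) J P"
    using rout by (auto simp: has_routing_def)
  obtain L where L: "\<And>i. i \<in> I \<Longrightarrow> connects i (L i)" using linkable by metis
  define Q where "Q i = (if i \<in> J then P i else L i)" for i
  have PJ: "\<And>i. i \<in> J \<Longrightarrow> connects i (P i)" "\<And>v. v \<in> pverts G \<Longrightarrow> int (load J P v) \<le> int (card J) - int d"
    using P is_routing_iff[of J] finJ sub JI by auto
  then have Q: "\<forall>i\<in>I. connects i (Q i)" using L by (auto simp: Q_def)
  have "int (load I Q v) \<le> int (card I) - int d" if v: "v \<in> pverts G" for v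
  proof -
    have "load I Q v = card {i \<in> I. v \<in> set (Q i)}" using load_eq_card fin Q by blast
    also have "\<dots> \<le> card ({i \<in> J. v \<in> set (P i)} \<union> (I - J))"
      using fin finJ by (intro card_mono) (auto simp: Q_def)
    also have "\<dots> \<le> load J P v + (card I - card J)"
      using card_Un_le[of "{i \<in> J. v \<in> set (P i)}" "I - J"] load_eq_card[OF finJ PJ(1)]
        card_Diff_subset[OF finJ JI] by simp
    finally show ?thesis using PJ(2)[OF v] card_mono[OF fin JI] by linarith
  qed
  then have "is_routing (with_proj G) (int (card I) - int d) I Q"
    using is_routing_iff[OF fin sub] Q by blast
  then show ?thesis by (auto simp: has_routing_def)
qed

lemma has_routing_iff_small:
  assumes "finite I" "I \<subseteq> pverts G \<times> pverts G"
  shows "has_routing (with_proj G) (int (card I) - int d) I \<longleftrightarrow>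
    (\<forall>i\<in>I. \<exists>p. connects i p) \<and>
    (\<exists>J\<subseteq>I. card J \<le> 3 * d \<and> has_routing (with_proj G) (int (card J) - int d) J)"
    (is "?L \<longleftrightarrow> ?R")
proof
  assume L: ?L
  then have "\<forall>i\<in>I. \<exists>p. connects i p"
    using is_routing_iff[OF assms] by (auto simp: has_routing_def)
  with small_subset_routing[OF assms L] show ?R by metis
next
  assume ?R
  then show ?L using extend_routing[OF assms] by blast
qed

end

section \<open>A pebble game\<close>

lemma (in acyclic_pair_digraph) path_reach:
  assumes "path p" "v \<in> set p"
  shows "(hd p, v) \<in> (parcs G)\<^sup>*"
proof (cases p)
  case (Cons u q)
  then show ?thesis
    using path_sorted[OF assms(1)] assms(2) by (auto dest: trancl_into_rtrancl)
qed (use assms in simp)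

lemma (in acyclic_pair_digraph) path_ConsI:
  assumes "path p" "(v, hd p) \<in> parcs G"
  shows "path (v # p)"
  using assms by (cases p) (auto simp: path_def)

lemma (in acyclic_pair_digraph) reach_iff_connects:
  "(s, t) \<in> (parcs G)\<^sup>* \<longleftrightarrow> (\<exists>p. connects (s, t) p)"
proof
  assume "(s, t) \<in> (parcs G)\<^sup>*"
  then show "\<exists>p. connects (s, t) p"
  proof (induction rule: converse_rtrancl_induct)
    case base
    have "connects (t, t) [t]" by (simp add: connects_def path_def)
    then show ?case ..
  next
    case (step u v)
    then obtain p where p: "connects (v, t) p" by blast
    then have "connects (u, t) (u # p)"
      using step(1) path_ConsI[of p u] by (auto simp: connects_def path_def)
    then show ?case ..
  qed
next
  assume "\<exists>p. connects (s, t) p"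
  then obtain p where "connects (s, t) p" by blast
  then show "(s, t) \<in> (parcs G)\<^sup>*"
    using path_reach[of p "last p"] by (auto simp: connects_def path_def)
qed

text \<open>
  A position consists of the current vertices and the targets of the pebbles; a pebble that has left
  its target is at \<open>z\<close>. A vertex \<open>v\<close> may only be left when no further pebble can arrive at \<open>v\<close>, so
  when the first pebble leaves \<open>v\<close> the number of pebbles at \<open>v\<close> is the load of \<open>v\<close>.
\<close>

locale pebble_game = acyclic_pair_digraph +
  fixes z :: 'a
  assumes z_notin_verts: "z \<notin> pverts G"
begin

definition move :: "nat \<Rightarrow> 'a list \<Rightarrow> 'a list \<Rightarrow> nat \<Rightarrow> 'a \<Rightarrow> bool" where
  "move c xs ts i w \<longleftrightarrow>
     xs ! i \<noteq> z \<and> (xs ! i = ts ! i \<and> w = z \<or> (xs ! i, w) \<in> parcs G) \<and>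
     (\<forall>j<length xs. xs ! j = xs ! i \<or> xs ! j = z \<or> (xs ! j, xs ! i) \<notin> (parcs G)\<^sup>*) \<and>
     card {j. j < length xs \<and> xs ! j = xs ! i} \<le> c"

text \<open>The index exceeds the number of moves by one: \<open>level c (Suc r)\<close> holds the
  positions won within \<open>r\<close> moves. The empty \<open>level c 0\<close> corresponds to a
  table without marks.\<close>

primrec level :: "nat \<Rightarrow> nat \<Rightarrow> ('a list \<times> 'a list) set" where
  "level c 0 = {}"
| "level c (Suc r) = {(xs, ts). (\<forall>x\<in>set xs. x = z) \<or>
     (\<exists>i<length xs. \<exists>w. move c xs ts i w \<and> (xs[i := w], ts) \<in> level c r)}"

text \<open>The parts of the paths still to be travelled from a position. A pebble at
  \<open>z\<close> has nothing left to visit, hence the empty list; a move removes the first vertex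
  of one path.\<close>

definition solution :: "nat \<Rightarrow> 'a list \<Rightarrow> 'a list \<Rightarrow> 'a list list \<Rightarrow> bool" where
  "solution c xs ts Ps \<longleftrightarrow> length Ps = length xs \<and>
     (\<forall>i<length xs. if xs ! i = z then Ps ! i = []
        else path (Ps ! i) \<and> hd (Ps ! i) = xs ! i \<and> last (Ps ! i) = ts ! i) \<and>
     (\<forall>v. card {i. i < length xs \<and> v \<in> set (Ps ! i)} \<le> c)"

lemma arcs_avoid_z: "(u, w) \<in> parcs G \<Longrightarrow> u \<noteq> z \<and> w \<noteq> z"
  using z_notin_verts arc_fst_in_verts arc_snd_in_verts by fastforce

text \<open>Undoing a move puts \<open>xs ! i\<close> in front of the rest of path \<open>i\<close>
  and changes the load of no other vertex. A path through \<open>xs ! i\<close> belongs to a pebble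
  that can reach this vertex; by the rule for moves such a pebble already stands there, and at most
  \<open>c\<close> pebbles do.\<close>

lemma level_imp_solution: "(xs, ts) \<in> level c r \<Longrightarrow> \<exists>Ps. solution c xs ts Ps"
proof (induction r arbitrary: xs)
  case (Suc r)
  show ?case
  proof (cases "\<forall>x\<in>set xs. x = z")
    case True
    then have "solution c xs ts (replicate (length xs) [])"
      by (auto simp: solution_def cong: conj_cong)
    then show ?thesis ..
  next
    case False
    then obtain i w where iw: "i < length xs" "move c xs ts i w" "(xs[i := w], ts) \<in> level c r"
      using Suc.prems by auto
    obtain Ps where Ps: "solution c (xs[i := w]) ts Ps" using Suc.IH[OF iw(3)] by blast
    let ?x = "xs ! i"
    define Qs where "Qs = Ps[i := ?x # Ps ! i]"
    have len: "length Ps = length xs" using Ps by (simp add: solution_def)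
    have nth: "if xs[i := w] ! j = z then Ps ! j = []
        else path (Ps ! j) \<and> hd (Ps ! j) = xs[i := w] ! j \<and> last (Ps ! j) = ts ! j"
      if "j < length xs" for j
      using Ps that by (simp add: solution_def)
    have Qi: "path (Qs ! i)" "hd (Qs ! i) = ?x" "last (Qs ! i) = ts ! i"
    proof -
      have "path (?x # Ps ! i) \<and> last (?x # Ps ! i) = ts ! i"
      proof (cases "w = z")
        case True
        then show ?thesis
          using nth[of i] iw(1,2) arcs_avoid_z by (auto simp: move_def path_def)
      next
        case False
        then show ?thesis
          using nth[of i] iw(1,2) path_ConsI[of "Ps ! i" ?x] by (auto simp: move_def path_def)
      qed
      then show "path (Qs ! i)" "hd (Qs ! i) = ?x" "last (Qs ! i) = ts ! i"
        using iw(1) len by (auto simp: Qs_def)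
    qed
    have Qj: "if xs ! j = z then Qs ! j = []
        else path (Qs ! j) \<and> hd (Qs ! j) = xs ! j \<and> last (Qs ! j) = ts ! j"
      if "j < length xs" for j
      using nth[OF that] Qi iw(2) by (cases "j = i") (auto simp: Qs_def move_def)
    have "card {j. j < length xs \<and> v \<in> set (Qs ! j)} \<le> c" for v
    proof (cases "v = ?x")
      case False
      then have "v \<in> set (Qs ! j) \<longleftrightarrow> v \<in> set (Ps ! j)" if "j < length xs" for j
        using len that by (cases "j = i") (auto simp: Qs_def)
      then show ?thesis using Ps by (simp add: solution_def cong: conj_cong)
    next
      case True
      have "{j. j < length xs \<and> v \<in> set (Qs ! j)} \<subseteq> {j. j < length xs \<and> xs ! j = ?x}"
      proof safe
        fix j assume j: "j < length xs" "v \<in> set (Qs ! j)"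
        then have "xs ! j \<noteq> z" using Qj[of j] by auto
        moreover from this j have "(xs ! j, ?x) \<in> (parcs G)\<^sup>*"
          using Qj[of j] path_reach[of "Qs ! j" v] True by auto
        ultimately show "xs ! j = ?x" using iw(2) j(1) by (auto simp: move_def)
      qed
      then have "card {j. j < length xs \<and> v \<in> set (Qs ! j)} \<le> card {j. j < length xs \<and> xs ! j = ?x}"
        by (intro card_mono) auto
      then show ?thesis using iw(2) by (simp add: move_def)
    qed
    then have "solution c xs ts Qs"
      using len Qj unfolding solution_def by (simp add: Qs_def[THEN arg_cong[of _ _ length]])
    then show ?thesis ..
  qed
qed simp

text \<open>Move a pebble whose vertex has the least height: since heights increase along paths, no
  pebble on another vertex can reach it. All pebbles standing there have the vertex on their paths,
  so the congestion of the solution bounds their number. Each move shortens the total length of the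
  paths by one.\<close>

lemma solution_imp_level:
  assumes "solution c xs ts Ps" "sum_list (map length Ps) \<le> r"
  shows "(xs, ts) \<in> level c (Suc r)"
  using assms
proof (induction r arbitrary: xs Ps)
  case 0
  have "xs ! i = z" if "i < length xs" for i
  proof (rule ccontr)
    assume "xs ! i \<noteq> z"
    then have "path (Ps ! i)" "Ps ! i \<in> set Ps" using 0(1) that by (auto simp: solution_def)
    then show False using 0(2) by (auto simp: path_def)
  qed
  then show ?case by (auto simp: in_set_conv_nth)
next
  case (Suc r)
  show ?case
  proof (cases "\<forall>x\<in>set xs. x = z")
    case False
    define S where "S = {i. i < length xs \<and> xs ! i \<noteq> z}"
    have "finite S" "S \<noteq> {}" using False by (auto simp: S_def in_set_conv_nth)
    then obtain i where i: "i \<in> S" "\<And>j. j \<in> S \<Longrightarrow> height (xs ! i) \<le> height (xs ! j)"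
      using finite_attains_min[of S "\<lambda>i. height (xs ! i)"] by blast
    let ?x = "xs ! i"
    have len: "length Ps = length xs" using Suc.prems by (simp add: solution_def)
    have il: "i < length xs" "?x \<noteq> z" using i(1) by (auto simp: S_def)
    have nth: "if xs ! j = z then Ps ! j = []
        else path (Ps ! j) \<and> hd (Ps ! j) = xs ! j \<and> last (Ps ! j) = ts ! j"
      if "j < length xs" for j
      using Suc.prems(1) that by (simp add: solution_def)
    obtain p where p: "Ps ! i = ?x # p"
      using nth[of i] il by (cases "Ps ! i") (auto simp: path_def)
    have pi: "path (?x # p)" "last (?x # p) = ts ! i" using nth[of i] il p by auto
    define w where "w = (if p = [] then z else hd p)"
    have w: "p = [] \<longleftrightarrow> w = z" "p \<noteq> [] \<Longrightarrow> path p \<and> hd p = w \<and> (?x, w) \<in> parcs G"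
      using pi(1) arcs_avoid_z by (auto simp: w_def path_def successively_Cons)
    have "move c xs ts i w"
    proof -
      have "xs ! j = ?x \<or> xs ! j = z \<or> (xs ! j, ?x) \<notin> (parcs G)\<^sup>*" if j: "j < length xs" for j
        using i(2)[of j] j height_less[of "xs ! j" ?x] by (auto simp: S_def rtrancl_eq_or_trancl)
      moreover have "card {j. j < length xs \<and> xs ! j = ?x} \<le> card {j. j < length xs \<and> ?x \<in> set (Ps ! j)}"
      proof (rule card_mono, simp, safe)
        fix j assume "j < length xs" "xs ! j = ?x"
        then show "?x \<in> set (Ps ! j)" using nth[of j] il(2) hd_in_set[of "Ps ! j"] by (simp add: path_def)
      qed
      moreover have "card {j. j < length xs \<and> ?x \<in> set (Ps ! j)} \<le> c"
        using Suc.prems(1) by (simp add: solution_def)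
      ultimately show ?thesis
        using il(2) w pi(2) by (auto simp: move_def)
    qed
    moreover have "(xs[i := w], ts) \<in> level c (Suc r)"
    proof (rule Suc.IH)
      have "card {j. j < length xs \<and> v \<in> set (Ps[i := p] ! j)} \<le> c" for v
      proof -
        have "card {j. j < length xs \<and> v \<in> set (Ps[i := p] ! j)} \<le> card {j. j < length xs \<and> v \<in> set (Ps ! j)}"
        proof (rule card_mono, simp, safe)
          fix j assume "j < length xs" "v \<in> set (Ps[i := p] ! j)"
          then show "v \<in> set (Ps ! j)" using p len by (cases "j = i") auto
        qed
        also have "\<dots> \<le> c" using Suc.prems(1) by (simp add: solution_def)
        finally show ?thesis .
      qed
      moreover have nth': "if xs[i := w] ! j = z then Ps[i := p] ! j = []
          else path (Ps[i := p] ! j) \<and> hd (Ps[i := p] ! j) = xs[i := w] ! j \<and> last (Ps[i := p] ! j) = ts ! j"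
        if "j < length xs" for j
        using nth[OF that] len w pi(2) that by (cases "j = i") auto
      ultimately show "solution c (xs[i := w]) ts (Ps[i := p])"
        using len nth' unfolding solution_def by simp
      have "sum_list (map length (Ps[i := p])) + 1 = sum_list (map length Ps)"
        using p il(1) len elem_le_sum_list[of i "map length Ps"] by (simp add: map_update sum_list_update)
      then show "sum_list (map length (Ps[i := p])) \<le> r" using Suc.prems(2) by simp
    qed
    ultimately show ?thesis using il(1) by (subst level.simps) blast
  qed simp
qed

lemma solution_size:
  assumes "solution c xs ts Ps" "set xs \<subseteq> insert z (pverts G)"
  shows "sum_list (map length Ps) \<le> length xs * card (pverts G)"
proof -
  have "length p \<le> card (pverts G)" if "p \<in> set Ps" for p
  proof -
    have "length Ps = length xs" using assms(1) by (simp add: solution_def)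
    with that obtain i where i: "i < length xs" "Ps ! i = p" by (auto simp: in_set_conv_nth)
    show ?thesis
    proof (cases "xs ! i = z")
      case False
      then have "xs ! i \<in> pverts G" using i(1) assms(2) nth_mem by blast
      with False have "path p" "hd p \<in> pverts G" using i assms(1) by (auto simp: solution_def)
      then have "set p \<subseteq> pverts G" "distinct p" using path_in_verts path_distinct by auto
      then show ?thesis using card_mono[OF pair_finite_verts, of "set p"] distinct_card[of p] by simp
    qed (use i assms(1) in \<open>auto simp: solution_def\<close>)
  qed
  then have "sum_list (map length Ps) \<le> sum_list (map (\<lambda>_. card (pverts G)) Ps)"
    by (intro sum_list_mono) auto
  also have "\<dots> = length xs * card (pverts G)"
    using assms(1) by (simp add: sum_list_triv solution_def)
  finally show ?thesis .
qed

text \<open>A win in any number of moves yields a solution, and playing that solution takes one move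
  per path vertex, at most \<open>card (pverts G)\<close> for each pebble. This fixes the number of
  rounds of the saturation.\<close>

lemma level_stable:
  assumes "set xs \<subseteq> insert z (pverts G)" "(xs, ts) \<in> level c r"
  shows "(xs, ts) \<in> level c (Suc (length xs * card (pverts G)))"
proof -
  obtain Ps where "solution c xs ts Ps" using level_imp_solution[OF assms(2)] by blast
  then show ?thesis using solution_imp_level solution_size assms(1) by blast
qed

section \<open>Winning positions and routings\<close>

definition winning :: "nat \<Rightarrow> 'a list \<Rightarrow> 'a list \<Rightarrow> bool" where
  "winning c xs ts \<longleftrightarrow> (\<exists>r. (xs, ts) \<in> level c r)"

lemma winning_iff_solution: "winning c xs ts \<longleftrightarrow> (\<exists>Ps. solution c xs ts Ps)"
  unfolding winning_def using level_imp_solution solution_imp_level by blast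

text \<open>For a lone pebble the waiting rule and the congestion bound of a move hold trivially.
  Its game can thus be solved before any reachability table exists, and its solution is that
  table.\<close>

lemma winning_single_iff:
  assumes "s \<in> pverts G"
  shows "winning 1 [s] [t] \<longleftrightarrow> (s, t) \<in> (parcs G)\<^sup>*"
proof -
  have s: "s \<noteq> z" using assms z_notin_verts by auto
  have "card {i. i < length [s] \<and> v \<in> set (Ps ! i)} \<le> 1" for v and Ps :: "'a list list"
    using card_mono[of "{0}" "{i. i < length [s] \<and> v \<in> set (Ps ! i)}"] by auto
  then have *: "solution 1 [s] [t] Ps \<longleftrightarrow> (\<exists>p. Ps = [p] \<and> connects (s, t) p)" for Ps
    using s by (cases Ps) (auto simp: solution_def connects_def)
  show ?thesis unfolding winning_iff_solution reach_iff_connects * by blast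
qed

lemma has_routing_iff_winning:
  assumes "distinct qs" "set qs \<subseteq> pverts G \<times> pverts G"
  shows "has_routing (with_proj G) (int c) (set qs) \<longleftrightarrow> winning c (map fst qs) (map snd qs)"
proof -
  have nz: "fst (qs ! i) \<noteq> z" if "i < length qs" for i
    using nth_mem[OF that] assms(2) z_notin_verts by auto
  have card: "card {q \<in> set qs. v \<in> set (P q)} = card {i. i < length qs \<and> v \<in> set (P (qs ! i))}"
    for P :: "'a \<times> 'a \<Rightarrow> 'a list" and v
  proof -
    have "{q \<in> set qs. v \<in> set (P q)} = (!) qs ` {i. i < length qs \<and> v \<in> set (P (qs ! i))}"
      by (auto simp: set_conv_nth[of qs])
    then show ?thesis
      by (simp add: card_image inj_on_def nth_eq_iff_index_eq[OF assms(1)])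
  qed
  show ?thesis
  proof
    assume "has_routing (with_proj G) (int c) (set qs)"
    then obtain P where "is_routing (with_proj G) (int c) (set qs) P" by (auto simp: has_routing_def)
    then have P: "\<And>q. q \<in> set qs \<Longrightarrow> connects q (P q)" "\<And>v. v \<in> pverts G \<Longrightarrow> load (set qs) P v \<le> c"
      using is_routing_iff[OF _ assms(2)] by auto
    \<comment> \<open>A solution is bounded at every \<open>v\<close>, a routing only at vertices of
      the digraph; no path visits anything else.\<close>
    have "card {i. i < length qs \<and> v \<in> set (P (qs ! i))} \<le> c" for v
    proof (cases "v \<in> pverts G")
      case True
      then show ?thesis using P(2)[OF True] load_eq_card[OF _ P(1)] card[of v P] by simp
    next
      case False
      have "set (P (qs ! i)) \<subseteq> pverts G" if "i < length qs" for i
      proof -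
        have "connects (qs ! i) (P (qs ! i))" "fst (qs ! i) \<in> pverts G"
          using P(1) nth_mem[OF that] assms(2) by auto
        then show ?thesis using path_in_verts by (auto simp: connects_def)
      qed
      with False have "{i. i < length qs \<and> v \<in> set (P (qs ! i))} = {}" by blast
      then show ?thesis by (simp only: card.empty)
    qed
    then have "solution c (map fst qs) (map snd qs) (map P qs)"
      using P(1) nz by (simp add: solution_def connects_def cong: conj_cong)
    then show "winning c (map fst qs) (map snd qs)" by (auto simp: winning_iff_solution)
  next
    assume "winning c (map fst qs) (map snd qs)"
    then obtain Ps where Ps: "solution c (map fst qs) (map snd qs) Ps" by (auto simp: winning_iff_solution)
    define P where "P q = the (map_of (zip qs Ps) q)" for q
    have PP: "P (qs ! i) = Ps ! i" if "i < length qs" for i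
      using Ps that assms(1) by (simp add: P_def map_of_zip_nth solution_def)
    have con: "connects q (P q)" if "q \<in> set qs" for q
      using that Ps nz PP by (auto simp: in_set_conv_nth solution_def connects_def)
    have "load (set qs) P v \<le> c" for v
    proof -
      have "load (set qs) P v = card {i. i < length qs \<and> v \<in> set (P (qs ! i))}"
        using load_eq_card[of "set qs" P v] con card by simp
      also have "\<dots> = card {i. i < length (map fst qs) \<and> v \<in> set (Ps ! i)}"
        using PP by (auto intro!: arg_cong[of _ _ card])
      also have "\<dots> \<le> c" using Ps by (simp add: solution_def)
      finally show ?thesis .
    qed
    then have "is_routing (with_proj G) (int c) (set qs) P"
      using is_routing_iff[of "set qs"] assms(2) con by simp
    then show "has_routing (with_proj G) (int c) (set qs)" by (auto simp: has_routing_def)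
  qed
qed

definition select :: "('a \<times> 'a) list \<Rightarrow> nat list \<Rightarrow> ('a \<times> 'a) list" where
  "select ps js = map ((!) ps) js"

text \<open>The range of \<open>m\<close> starts above \<open>d\<close> because at most
  \<open>d\<close> pairs never work: the bound at an existing vertex forces
  \<open>card J = d\<close> with all loads zero, but then \<open>J\<close> is nonempty and a path
  loads its own source. So \<open>m - d\<close> is a positive natural number. Lists of distinct
  indices stand for subsets, since the program enumerates index tuples.\<close>

lemma routing_by_winning:
  assumes "distinct ps" "set ps \<subseteq> pverts G \<times> pverts G" "pverts G \<noteq> {}" "1 \<le> d"
  shows "has_routing (with_proj G) (int (length ps) - int d) (set ps) \<longleftrightarrow>
    (\<forall>(s, t)\<in>set ps. winning 1 [s] [t]) \<and>
    (\<exists>m\<in>{d<..3 * d}. \<exists>js. length js = m \<and> distinct js \<and> set js \<subseteq> {..<length ps} \<and>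
       winning (m - d) (map fst (select ps js)) (map snd (select ps js)))"
    (is "_ \<longleftrightarrow> _ \<and> ?W")
proof -
  have len: "length ps = card (set ps)" using assms(1) by (simp add: distinct_card)
  have 1: "(\<forall>i\<in>set ps. \<exists>p. connects i p) \<longleftrightarrow> (\<forall>(s, t)\<in>set ps. winning 1 [s] [t])"
    using assms(2) winning_single_iff reach_iff_connects by fastforce
  have sel: "set (select ps js) \<subseteq> set ps \<and> distinct (select ps js)"
    if "distinct js" "set js \<subseteq> {..<length ps}" for js
    using that assms(1)
    by (auto simp: select_def distinct_map inj_on_def nth_eq_iff_index_eq subset_iff)
  have 2: "(\<exists>J\<subseteq>set ps. card J \<le> 3 * d \<and> has_routing (with_proj G) (int (card J) - int d) J) \<longleftrightarrow> ?W"
  proof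
    assume "\<exists>J\<subseteq>set ps. card J \<le> 3 * d \<and> has_routing (with_proj G) (int (card J) - int d) J"
    then obtain J where J: "J \<subseteq> set ps" "card J \<le> 3 * d" "has_routing (with_proj G) (int (card J) - int d) J"
      by blast
    have finJ: "finite J" using J(1) finite_subset by blast
    have subJ: "J \<subseteq> pverts G \<times> pverts G" using J(1) assms(2) by auto
    obtain P where P: "is_routing (with_proj G) (int (card J) - int d) J P"
      using J(3) by (auto simp: has_routing_def)
    then have P1: "\<And>i. i \<in> J \<Longrightarrow> connects i (P i)"
      and P2: "\<And>v. v \<in> pverts G \<Longrightarrow> int (load J P v) \<le> int (card J) - int d"
      using is_routing_iff[OF finJ subJ] by auto
    have "d < card J"
    proof (rule ccontr)
      assume "\<not> d < card J"
      then have 0: "load J P v = 0 \<and> card J = d" if "v \<in> pverts G" for v using P2[OF that] by simp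
      obtain v where "v \<in> pverts G" using assms(3) by blast
      from 0[OF this] assms(4) have "J \<noteq> {}" by auto
      then obtain i where i: "i \<in> J" by blast
      have "fst i \<in> pverts G" using i subJ by auto
      then have "card {j \<in> J. fst i \<in> set (P j)} = 0"
        using 0[of "fst i"] load_eq_card[OF finJ P1] by simp
      moreover have "fst i \<in> set (P i)"
        using P1[OF i] hd_in_set[of "P i"] by (simp add: connects_def path_def)
      ultimately show False using finJ i by (cases i) auto
    qed
    define js where "js = sorted_list_of_set {j. j < length ps \<and> ps ! j \<in> J}"
    have js: "distinct js" "set js = {j. j < length ps \<and> ps ! j \<in> J}" by (auto simp: js_def)
    have selJ: "set (select ps js) = J"
    proof
      show "J \<subseteq> set (select ps js)"
      proof
        fix q assume q: "q \<in> J"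
        then have "q \<in> set ps" using J(1) by blast
        then obtain i where "i < length ps" "ps ! i = q" by (auto simp: in_set_conv_nth)
        then show "q \<in> set (select ps js)" using q js(2) by (auto simp: select_def)
      qed
    qed (auto simp: select_def js(2))
    have "distinct (select ps js)" using sel[OF js(1)] js(2) by auto
    then have lenjs: "length js = card J" using selJ distinct_card by (fastforce simp: select_def)
    have "winning (card J - d) (map fst (select ps js)) (map snd (select ps js))"
      using has_routing_iff_winning[of "select ps js" "card J - d"] J(3) \<open>d < card J\<close> selJ subJ
        \<open>distinct (select ps js)\<close> by (simp add: of_nat_diff)
    then show ?W using lenjs js \<open>d < card J\<close> J(2) by (intro bexI[of _ "card J"] exI[of _ js]) auto
  next
    assume ?W
    then obtain m js where m: "d < m" "m \<le> 3 * d" "length js = m" "distinct js" "set js \<subseteq> {..<length ps}"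
      and w: "winning (m - d) (map fst (select ps js)) (map snd (select ps js))" by auto
    let ?J = "set (select ps js)"
    have s: "?J \<subseteq> set ps" "distinct (select ps js)" using sel m by auto
    have c: "card ?J = m" using s(2) m(3) distinct_card[of "select ps js"] by (simp add: select_def)
    have "has_routing (with_proj G) (int (card ?J) - int d) ?J"
      using has_routing_iff_winning[OF s(2), of "m - d"] w s(1) assms(2) m(1) c by (auto simp: of_nat_diff)
    then show "\<exists>J\<subseteq>set ps. card J \<le> 3 * d \<and> has_routing (with_proj G) (int (card J) - int d) J"
      using s(1) c m(2) by blast
  qed
  show ?thesis
    unfolding len has_routing_iff_small[OF finite_set assms(2)] 1 2[unfolded len] by simp
qed

end

section \<open>Programming the machine\<close>

text \<open>An upper bound on the time, in place of the exact count of \<open>exec\<close>, gives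
  both branches of a conditional and all rounds of a loop one common bound.\<close>

definition runs :: "nat \<Rightarrow> com \<Rightarrow> store \<Rightarrow> store \<Rightarrow> bool" where
  "runs t p \<sigma> \<tau> \<longleftrightarrow> (\<exists>s\<le>t. exec p \<sigma> s \<tau>)"

lemma runs_mono: "runs t p \<sigma> \<tau> \<Longrightarrow> t \<le> u \<Longrightarrow> runs u p \<sigma> \<tau>"
  unfolding runs_def using le_trans by blast

lemma runs_Assign: "runs (1 + cost e) (Assign r e) \<sigma> (set_reg r (val e \<sigma>) \<sigma>)"
  unfolding runs_def using exec.Assign by blast

lemma runs_Write: "runs (1 + cost e + cost f) (Write a e f) \<sigma> (set_arr a (val e \<sigma>) (val f \<sigma>) \<sigma>)"
  unfolding runs_def using exec.Write by blast

lemma runs_Seq: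
  assumes "runs t p \<sigma> \<tau>" "runs u q \<tau> \<rho>"
  shows "runs (t + u + 1) (Seq p q) \<sigma> \<rho>"
proof -
  obtain s s' where s: "s \<le> t" "exec p \<sigma> s \<tau>" "s' \<le> u" "exec q \<tau> s' \<rho>"
    using assms unfolding runs_def by blast
  have "exec (Seq p q) \<sigma> (1 + s + s') \<rho>" using s by (blast intro: exec.Seq)
  moreover have "1 + s + s' \<le> t + u + 1" using s by simp
  ultimately show ?thesis unfolding runs_def by blast
qed

lemma set_reg_sel [simp]:
  "reg (set_reg r v \<sigma>) = (reg \<sigma>)(r := v)" "arr (set_reg r v \<sigma>) = arr \<sigma>"
  by (simp_all add: set_reg_def)

lemma set_arr_sel [simp]:
  "reg (set_arr a i v \<sigma>) = reg \<sigma>" "arr (set_arr a i v \<sigma>) = (arr \<sigma>)(a := (arr \<sigma> a)(i := v))"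
  by (simp_all add: set_arr_def)

section \<open>Counting loops, nests of loops and marking sweeps\<close>

definition for_c :: "nat \<Rightarrow> exp \<Rightarrow> com \<Rightarrow> com" where
  "for_c r e p = Seq (Assign r (Const 0))
     (While (Sub e (Reg r)) (Seq p (Assign r (Add (Reg r) (Const 1)))))"

text \<open>The invariant \<open>I v\<close> refers to the moment when the counter already holds
  \<open>v\<close>. The value of \<open>e\<close> is required for every \<open>v\<close>, because
  the guard evaluates \<open>e\<close> anew in each round.\<close>

lemma for_runs:
  assumes init: "I 0 (set_reg r 0 \<sigma>)"
    and bound: "\<And>v \<sigma>. v \<le> N \<Longrightarrow> I v \<sigma> \<Longrightarrow> reg \<sigma> r = v \<Longrightarrow> val e \<sigma> = N"
    and step: "\<And>v \<sigma>. v < N \<Longrightarrow> I v \<sigma> \<Longrightarrow> reg \<sigma> r = v \<Longrightarrow>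
      \<exists>\<tau>. runs t p \<sigma> \<tau> \<and> reg \<tau> r = v \<and> I (Suc v) (set_reg r (Suc v) \<tau>)"
  shows "\<exists>\<tau>. runs ((N + 1) * (t + cost e + 8)) (for_c r e p) \<sigma> \<tau> \<and> I N \<tau>"
proof -
  let ?b = "Seq p (Assign r (Add (Reg r) (Const 1)))"
  let ?w = "While (Sub e (Reg r)) ?b"
  \<comment> \<open>One round costs \<open>t\<close> for the body, \<open>cost e + 3\<close> for the
    test and 5 for the increment with its sequencing.\<close>
  let ?u = "t + cost e + 8"
  have loop: "\<exists>\<tau>. runs ((N - v) * ?u + cost e + 3) ?w \<sigma> \<tau> \<and> I N \<tau>"
    if "v \<le> N" "I v \<sigma>" "reg \<sigma> r = v" for v \<sigma>
    using that
  proof (induction "N - v" arbitrary: v \<sigma>)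
    case 0
    then have v: "v = N" by simp
    have "val (Sub e (Reg r)) \<sigma> = 0" using bound[OF 0(2-4)] 0(4) v by simp
    from exec.WhileFalse[OF this, of ?b] have "runs (cost e + 3) ?w \<sigma> \<sigma>"
      unfolding runs_def by (auto intro!: exI[of _ "cost e + 3"] simp: eval_nat_numeral)
    then show ?case using 0(3) v by auto
  next
    case (Suc l)
    then have v: "v < N" by simp
    obtain \<tau> where \<tau>: "runs t p \<sigma> \<tau>" "reg \<tau> r = v" "I (Suc v) (set_reg r (Suc v) \<tau>)"
      using step[OF v Suc.prems(2,3)] by blast
    let ?\<tau> = "set_reg r (Suc v) \<tau>"
    have "runs (t + (1 + cost (Add (Reg r) (Const 1))) + 1) ?b \<sigma> ?\<tau>"
      using runs_Seq[OF \<tau>(1) runs_Assign[of "Add (Reg r) (Const 1)" r \<tau>]] \<tau>(2) by simp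
    then obtain s where s: "s \<le> t + 5" "exec ?b \<sigma> s ?\<tau>"
      by (auto simp: runs_def eval_nat_numeral)
    have l: "l = N - Suc v" using Suc.hyps(2) by simp
    obtain \<rho> where \<rho>: "runs ((N - Suc v) * ?u + cost e + 3) ?w ?\<tau> \<rho>" "I N \<rho>"
      using Suc.hyps(1)[OF l _ \<tau>(3)] v by fastforce
    then obtain s' where s': "s' \<le> (N - Suc v) * ?u + cost e + 3" "exec ?w ?\<tau> s' \<rho>"
      by (auto simp: runs_def)
    have "val (Sub e (Reg r)) \<sigma> \<noteq> 0" using bound[OF Suc.prems] Suc.prems(3) v by simp
    from exec.WhileTrue[OF this s(2) s'(2)]
    have "exec ?w \<sigma> (1 + cost (Sub e (Reg r)) + s + s') \<rho>" .
    moreover have "N - v = Suc (N - Suc v)" using v by simp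
    then have "1 + cost (Sub e (Reg r)) + s + s' \<le> (N - v) * ?u + cost e + 3"
      using s(1) s'(1) by simp
    ultimately have "runs ((N - v) * ?u + cost e + 3) ?w \<sigma> \<rho>" unfolding runs_def by blast
    then show ?case using \<rho>(2) by blast
  qed
  obtain \<tau> where \<tau>: "runs (N * ?u + cost e + 3) ?w (set_reg r 0 \<sigma>) \<tau>" "I N \<tau>"
    using loop[of 0 "set_reg r 0 \<sigma>"] init by auto
  have "runs (1 + cost (Const 0)) (Assign r (Const 0)) \<sigma> (set_reg r 0 \<sigma>)"
    using runs_Assign[of "Const 0" r \<sigma>] by simp
  from runs_Seq[OF this \<tau>(1)] have "runs ((N + 1) * ?u) (for_c r e p) \<sigma> \<tau>"
    unfolding for_c_def by (rule runs_mono) simp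
  with \<tau>(2) show ?thesis by blast
qed

primrec nest :: "nat list \<Rightarrow> exp \<Rightarrow> com \<Rightarrow> com" where
  "nest [] e p = p"
| "nest (r # rs) e p = for_c r e (nest rs e p)"

text \<open>Marks are never erased. What an early iteration has established about marked cells
  therefore still holds when the loops end.\<close>

definition grows :: "(nat \<Rightarrow> nat \<Rightarrow> nat) \<Rightarrow> (nat \<Rightarrow> nat \<Rightarrow> nat) \<Rightarrow> bool" where
  "grows A A' \<longleftrightarrow> (\<forall>a i. A a i \<noteq> 0 \<longrightarrow> A' a i \<noteq> 0)"

text \<open>\<open>J\<close> is an invariant and \<open>Q ys\<close> is what the body achieves at
  the counter values \<open>ys\<close>; monotonicity preserves it through later iterations. In the
  induction the counter of the outer loop becomes a fixed register of the inner nest, hence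
  \<open>\<rho>(r := v)\<close> and the predicate \<open>\<lambda>ys. Q (v # ys)\<close>.\<close>

lemma nest_runs:
  assumes "distinct rs"
    and mono: "\<And>ys A A'. grows A A' \<Longrightarrow> Q ys A \<Longrightarrow> Q ys A'"
    and bound: "\<And>\<sigma> :: store. \<forall>r. r \<notin> set rs \<longrightarrow> reg \<sigma> r = \<rho> r \<Longrightarrow> J (arr \<sigma>) \<Longrightarrow> val e \<sigma> = N"
    and body: "\<And>ys (\<sigma> :: store). length ys = length rs \<Longrightarrow> set ys \<subseteq> {..<N} \<Longrightarrow> map (reg \<sigma>) rs = ys \<Longrightarrow>
      \<forall>r. r \<notin> set rs \<longrightarrow> reg \<sigma> r = \<rho> r \<Longrightarrow> J (arr \<sigma>) \<Longrightarrow>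
      \<exists>\<tau>. runs t p \<sigma> \<tau> \<and> reg \<tau> = reg \<sigma> \<and> J (arr \<tau>) \<and> grows (arr \<sigma>) (arr \<tau>) \<and> Q ys (arr \<tau>)"
    and "\<forall>r. r \<notin> set rs \<longrightarrow> reg \<sigma> r = \<rho> r" "J (arr \<sigma>)"
  shows "\<exists>\<tau>. runs ((N + 1) ^ length rs * (t + length rs * (cost e + 8))) (nest rs e p) \<sigma> \<tau> \<and>
    (\<forall>r. r \<notin> set rs \<longrightarrow> reg \<tau> r = \<rho> r) \<and> J (arr \<tau>) \<and> grows (arr \<sigma>) (arr \<tau>) \<and>
    (\<forall>ys. length ys = length rs \<longrightarrow> set ys \<subseteq> {..<N} \<longrightarrow> Q ys (arr \<tau>))"
  using assms
proof (induction rs arbitrary: Q \<rho> \<sigma>)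
  case Nil
  have "\<exists>\<tau>. runs t p \<sigma> \<tau> \<and> reg \<tau> = reg \<sigma> \<and> J (arr \<tau>) \<and> grows (arr \<sigma>) (arr \<tau>) \<and> Q [] (arr \<tau>)"
    by (rule Nil.prems(4)) (use Nil.prems(5,6) in simp_all)
  then obtain \<tau> where "runs t p \<sigma> \<tau>" "reg \<tau> = reg \<sigma>" "J (arr \<tau>)" "grows (arr \<sigma>) (arr \<tau>)" "Q [] (arr \<tau>)"
    by blast
  then show ?case using Nil.prems(5) by (intro exI[of _ \<tau>]) simp
next
  case (Cons r rs)
  let ?h = "cost e + 8"
  let ?t = "(N + 1) ^ length rs * (t + length rs * ?h)"
  define I where "I v \<tau> \<longleftrightarrow> (\<forall>x. x \<notin> set (r # rs) \<longrightarrow> reg \<tau> x = \<rho> x) \<and> J (arr \<tau>) \<and>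
    grows (arr \<sigma>) (arr \<tau>) \<and>
    (\<forall>ys. length ys = length (r # rs) \<longrightarrow> set ys \<subseteq> {..<N} \<longrightarrow> hd ys < v \<longrightarrow> Q ys (arr \<tau>))"
    for v and \<tau> :: store
  have "\<exists>\<tau>. runs ((N + 1) * (?t + cost e + 8)) (for_c r e (nest rs e p)) \<sigma> \<tau> \<and> I N \<tau>"
  proof (rule for_runs)
    show "I 0 (set_reg r 0 \<sigma>)" using Cons.prems(5,6) by (auto simp: I_def grows_def)
    show "val e \<tau> = N" if "I v \<tau>" for v \<tau>
      using that Cons.prems(3)[of \<tau>] by (auto simp: I_def)
    fix v \<tau> assume v: "v < N" "I v \<tau>" "reg \<tau> r = v"
    let ?\<rho> = "\<rho>(r := v)"
    have "\<exists>\<tau>'. runs ?t (nest rs e p) \<tau> \<tau>' \<and> (\<forall>x. x \<notin> set rs \<longrightarrow> reg \<tau>' x = ?\<rho> x) \<and> J (arr \<tau>') \<and>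
      grows (arr \<tau>) (arr \<tau>') \<and> (\<forall>ys. length ys = length rs \<longrightarrow> set ys \<subseteq> {..<N} \<longrightarrow> Q (v # ys) (arr \<tau>'))"
    proof (rule Cons.IH[where Q = "\<lambda>ys. Q (v # ys)" and \<rho> = ?\<rho>])
      show "distinct rs" using Cons.prems(1) by simp
      show "Q (v # ys) A'" if "grows A A'" "Q (v # ys) A" for ys A A'
        using that Cons.prems(2) by blast
      show "val e \<sigma>' = N" if "\<forall>x. x \<notin> set rs \<longrightarrow> reg \<sigma>' x = ?\<rho> x" "J (arr \<sigma>')" for \<sigma>' :: store
        using that Cons.prems(3)[of \<sigma>'] by auto
      show "\<exists>\<tau>'. runs t p \<sigma>' \<tau>' \<and> reg \<tau>' = reg \<sigma>' \<and> J (arr \<tau>') \<and> grows (arr \<sigma>') (arr \<tau>') \<and>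
          Q (v # ys) (arr \<tau>')"
        if "length ys = length rs" "set ys \<subseteq> {..<N}" "map (reg \<sigma>') rs = ys"
          "\<forall>x. x \<notin> set rs \<longrightarrow> reg \<sigma>' x = ?\<rho> x" "J (arr \<sigma>')" for ys \<sigma>'
        using that v(1) Cons.prems(1) by (intro Cons.prems(4)) auto
      show "\<forall>x. x \<notin> set rs \<longrightarrow> reg \<tau> x = ?\<rho> x" "J (arr \<tau>)"
        using v(2,3) by (auto simp: I_def)
    qed
    then obtain \<tau>' where \<tau>': "runs ?t (nest rs e p) \<tau> \<tau>'" "\<forall>x. x \<notin> set rs \<longrightarrow> reg \<tau>' x = ?\<rho> x"
      "J (arr \<tau>')" "grows (arr \<tau>) (arr \<tau>')"
      "\<And>ys. length ys = length rs \<Longrightarrow> set ys \<subseteq> {..<N} \<Longrightarrow> Q (v # ys) (arr \<tau>')"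
      by blast
    have "Q ys (arr \<tau>')" if ys: "length ys = length (r # rs)" "set ys \<subseteq> {..<N}" "hd ys < Suc v" for ys
    proof (cases "hd ys = v")
      case True
      then show ?thesis using \<tau>'(5)[of "tl ys"] ys by (cases ys) auto
    next
      case False
      then have "Q ys (arr \<tau>)" using v(2) ys by (auto simp: I_def)
      then show ?thesis using Cons.prems(2) \<tau>'(4) by blast
    qed
    moreover have "grows (arr \<sigma>) (arr \<tau>')" using v(2) \<tau>'(4) by (auto simp: I_def grows_def)
    moreover have "reg \<tau>' r = v" using \<tau>'(2) Cons.prems(1) by auto
    ultimately show "\<exists>\<tau>'. runs ?t (nest rs e p) \<tau> \<tau>' \<and> reg \<tau>' r = v \<and> I (Suc v) (set_reg r (Suc v) \<tau>')"
      using \<tau>'(1-3) by (intro exI[of _ \<tau>']) (simp add: I_def)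
  qed
  then obtain \<tau> where \<tau>: "runs ((N + 1) * (?t + cost e + 8)) (nest (r # rs) e p) \<sigma> \<tau>" "I N \<tau>" by auto
  have "1 * ?h \<le> (N + 1) ^ length rs * ?h" by (intro mult_right_mono) auto
  then have "(N + 1) * (?t + cost e + 8) \<le> (N + 1) * (?t + (N + 1) ^ length rs * ?h)"
    by (intro mult_left_mono) auto
  also have "\<dots> = (N + 1) ^ length (r # rs) * (t + length (r # rs) * ?h)"
    by (simp add: algebra_simps)
  finally have "runs ((N + 1) ^ length (r # rs) * (t + length (r # rs) * ?h)) (nest (r # rs) e p) \<sigma> \<tau>"
    using \<tau>(1) runs_mono by blast
  moreover have "Q ys (arr \<tau>)" if "length ys = length (r # rs)" "set ys \<subseteq> {..<N}" for ys
  proof -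
    have "hd ys < N" using that by (cases ys) auto
    then show ?thesis using that \<tau>(2) by (auto simp: I_def)
  qed
  moreover have "\<forall>x. x \<notin> set (r # rs) \<longrightarrow> reg \<tau> x = \<rho> x" "J (arr \<tau>)" "grows (arr \<sigma>) (arr \<tau>)"
    using \<tau>(2) unfolding I_def by blast+
  ultimately show ?case by blast
qed

definition mark :: "exp \<Rightarrow> nat \<Rightarrow> exp \<Rightarrow> com" where
  "mark e a f = Cond e (Write a f (Const 1)) Skip"

lemma runs_mark:
  "runs (cost e + cost f + 3) (mark e a f) \<sigma> (if val e \<sigma> = 0 then \<sigma> else set_arr a (val f \<sigma>) 1 \<sigma>)"
proof (cases "val e \<sigma> = 0")
  case True
  from exec.CondFalse[OF True exec.Skip, of "Write a f (Const 1)"]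
  have "exec (mark e a f) \<sigma> (1 + cost e + 1) \<sigma>" unfolding mark_def .
  then show ?thesis unfolding runs_def by (intro exI[of _ "1 + cost e + 1"]) (simp add: True)
next
  case False
  from exec.CondTrue[OF False exec.Write, of a f "Const 1" Skip]
  have "exec (mark e a f) \<sigma> (1 + cost e + (1 + cost f + 1)) (set_arr a (val f \<sigma>) 1 \<sigma>)"
    unfolding mark_def by simp
  then show ?thesis
    unfolding runs_def by (intro exI[of _ "1 + cost e + (1 + cost f + 1)"]) (simp add: False)
qed

text \<open>Soundness (\<open>inv\<close>) and completeness (\<open>fires\<close>) are separate
  hypotheses because the guard may read the array being marked: it can fire for more tuples than
  \<open>\<Phi>\<close> describes, thanks to marks made earlier in the same sweep.\<close>

lemma nest_mark:
  assumes "distinct rs"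
    and bound: "\<And>\<sigma> :: store. \<forall>r. r \<notin> set rs \<longrightarrow> reg \<sigma> r = \<rho> r \<Longrightarrow> J (arr \<sigma>) \<Longrightarrow> val b \<sigma> = N"
    and index: "\<And>ys (\<sigma> :: store). length ys = length rs \<Longrightarrow> set ys \<subseteq> {..<N} \<Longrightarrow> map (reg \<sigma>) rs = ys \<Longrightarrow>
      \<forall>r. r \<notin> set rs \<longrightarrow> reg \<sigma> r = \<rho> r \<Longrightarrow> J (arr \<sigma>) \<Longrightarrow> val f \<sigma> = F ys"
    and inv: "\<And>ys (\<sigma> :: store). length ys = length rs \<Longrightarrow> set ys \<subseteq> {..<N} \<Longrightarrow> map (reg \<sigma>) rs = ys \<Longrightarrow>
      \<forall>r. r \<notin> set rs \<longrightarrow> reg \<sigma> r = \<rho> r \<Longrightarrow> J (arr \<sigma>) \<Longrightarrow> val e \<sigma> \<noteq> 0 \<Longrightarrow>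
      J ((arr \<sigma>)(a := (arr \<sigma> a)(F ys := 1)))"
    and fires: "\<And>ys (\<sigma> :: store). length ys = length rs \<Longrightarrow> set ys \<subseteq> {..<N} \<Longrightarrow> map (reg \<sigma>) rs = ys \<Longrightarrow>
      \<forall>r. r \<notin> set rs \<longrightarrow> reg \<sigma> r = \<rho> r \<Longrightarrow> J (arr \<sigma>) \<Longrightarrow> \<Phi> ys \<Longrightarrow> val e \<sigma> \<noteq> 0"
    and init: "\<forall>r. r \<notin> set rs \<longrightarrow> reg \<sigma> r = \<rho> r" "J (arr \<sigma>)"
  shows "\<exists>\<tau>. runs ((N + 1) ^ length rs * (cost e + cost f + 3 + length rs * (cost b + 8)))
      (nest rs b (mark e a f)) \<sigma> \<tau> \<and>
    (\<forall>r. r \<notin> set rs \<longrightarrow> reg \<tau> r = \<rho> r) \<and> J (arr \<tau>) \<and>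
    (\<forall>ys. length ys = length rs \<longrightarrow> set ys \<subseteq> {..<N} \<longrightarrow> \<Phi> ys \<longrightarrow> arr \<tau> a (F ys) \<noteq> 0)"
proof -
  define Q where "Q ys A \<longleftrightarrow> (\<Phi> ys \<longrightarrow> A a (F ys) \<noteq> 0)" for ys and A :: "nat \<Rightarrow> nat \<Rightarrow> nat"
  have "\<exists>\<tau>. runs ((N + 1) ^ length rs * (cost e + cost f + 3 + length rs * (cost b + 8)))
      (nest rs b (mark e a f)) \<sigma> \<tau> \<and> (\<forall>r. r \<notin> set rs \<longrightarrow> reg \<tau> r = \<rho> r) \<and> J (arr \<tau>) \<and> grows (arr \<sigma>) (arr \<tau>) \<and>
    (\<forall>ys. length ys = length rs \<longrightarrow> set ys \<subseteq> {..<N} \<longrightarrow> Q ys (arr \<tau>))"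
  proof (rule nest_runs[OF assms(1)])
    show "Q ys A'" if "grows A A'" "Q ys A" for ys A A'
      using that by (auto simp: Q_def grows_def)
    show "val b \<sigma> = N" if "\<forall>r. r \<notin> set rs \<longrightarrow> reg \<sigma> r = \<rho> r" "J (arr \<sigma>)" for \<sigma> :: store
      using that by (rule bound)
    fix ys and \<sigma> :: store assume a: "length ys = length rs" "set ys \<subseteq> {..<N}" "map (reg \<sigma>) rs = ys"
      "\<forall>r. r \<notin> set rs \<longrightarrow> reg \<sigma> r = \<rho> r" "J (arr \<sigma>)"
    let ?\<tau> = "if val e \<sigma> = 0 then \<sigma> else set_arr a (val f \<sigma>) 1 \<sigma>"
    have "reg ?\<tau> = reg \<sigma> \<and> J (arr ?\<tau>) \<and> grows (arr \<sigma>) (arr ?\<tau>) \<and> Q ys (arr ?\<tau>)"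
      using index[OF a] inv[OF a] fires[OF a] a(5) by (cases "val e \<sigma> = 0") (auto simp: grows_def Q_def)
    then show "\<exists>\<tau>. runs (cost e + cost f + 3) (mark e a f) \<sigma> \<tau> \<and> reg \<tau> = reg \<sigma> \<and> J (arr \<tau>) \<and>
        grows (arr \<sigma>) (arr \<tau>) \<and> Q ys (arr \<tau>)"
      using runs_mark[of e f a \<sigma>] by blast
  qed (use init in auto)
  then show ?thesis unfolding Q_def by blast
qed

section \<open>Logical expressions from truncated subtraction, with nonzero as true\<close>

definition not_e :: "exp \<Rightarrow> exp" where "not_e e = Sub (Const 1) e"
definition and_e :: "exp \<Rightarrow> exp \<Rightarrow> exp" where "and_e e f = not_e (Add (not_e e) (not_e f))"
definition eq_e :: "exp \<Rightarrow> exp \<Rightarrow> exp" where "eq_e e f = not_e (Add (Sub e f) (Sub f e))"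
definition sum_e :: "exp list \<Rightarrow> exp" where "sum_e es = foldr Add es (Const 0)"
definition all_e :: "exp list \<Rightarrow> exp" where "all_e es = not_e (sum_e (map not_e es))"

lemma val_not_e [simp]: "val (not_e e) \<sigma> = (if val e \<sigma> = 0 then 1 else 0)"
  by (simp add: not_e_def)

lemma val_and_e [simp]: "val (and_e e f) \<sigma> = (if val e \<sigma> \<noteq> 0 \<and> val f \<sigma> \<noteq> 0 then 1 else 0)"
  by (simp add: and_e_def)

lemma val_eq_e [simp]: "val (eq_e e f) \<sigma> = (if val e \<sigma> = val f \<sigma> then 1 else 0)"
  by (auto simp: eq_e_def)

lemma val_sum_e [simp]: "val (sum_e es) \<sigma> = (\<Sum>e\<leftarrow>es. val e \<sigma>)"
  by (induction es) (auto simp: sum_e_def)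

lemma val_all_e [simp]: "val (all_e es) \<sigma> = (if \<forall>e\<in>set es. val e \<sigma> \<noteq> 0 then 1 else 0)"
proof -
  have "(\<Sum>e\<leftarrow>map not_e es. val e \<sigma>) = 0 \<longleftrightarrow> (\<forall>e\<in>set es. val e \<sigma> \<noteq> 0)"
    by (induction es) auto
  then show ?thesis unfolding all_e_def val_not_e val_sum_e by presburger
qed

primrec seq_c :: "com list \<Rightarrow> com" where
  "seq_c [] = Skip"
| "seq_c (p # ps) = Seq p (seq_c ps)"

lemma runs_Skip: "runs 1 Skip \<sigma> \<sigma>"
  unfolding runs_def using exec.Skip by blast

text \<open>The loop goes one step beyond the values \<open>0, ..., n\<close> that are looked up:
  entry \<open>n + 1\<close> of the multiples of \<open>(n + 1) ^ i\<close> is the next power, from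
  which the next table is built.\<close>

definition multiples_c :: "nat \<Rightarrow> exp \<Rightarrow> com" where
  "multiples_c a e = for_c 2 (Add (Reg 0) (Const 1))
     (Write a (Add (Reg 2) (Const 1)) (Add (Read a (Reg 2)) e))"

lemma multiples_runs:
  assumes "arr \<sigma> a 0 = 0"
    and e: "\<And>\<tau>. \<forall>r. r \<noteq> 2 \<longrightarrow> reg \<tau> r = reg \<sigma> r \<Longrightarrow> \<forall>b. b \<noteq> a \<longrightarrow> arr \<tau> b = arr \<sigma> b \<Longrightarrow> val e \<tau> = c"
  shows "\<exists>\<tau>. runs ((reg \<sigma> 0 + 2) * (cost e + 18)) (multiples_c a e) \<sigma> \<tau> \<and>
    (\<forall>r. r \<noteq> 2 \<longrightarrow> reg \<tau> r = reg \<sigma> r) \<and> (\<forall>b. b \<noteq> a \<longrightarrow> arr \<tau> b = arr \<sigma> b) \<and>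
    (\<forall>v\<le>Suc (reg \<sigma> 0). arr \<tau> a v = v * c)"
proof -
  let ?n = "reg \<sigma> 0"
  define I where "I v \<tau> \<longleftrightarrow> (\<forall>r. r \<noteq> 2 \<longrightarrow> reg \<tau> r = reg \<sigma> r) \<and> (\<forall>b. b \<noteq> a \<longrightarrow> arr \<tau> b = arr \<sigma> b) \<and>
    (\<forall>u\<le>v. arr \<tau> a u = u * c)" for v and \<tau> :: store
  let ?p = "Write a (Add (Reg 2) (Const 1)) (Add (Read a (Reg 2)) e)"
  have "\<exists>\<tau>. runs ((Suc ?n + 1) * (cost e + 7 + cost (Add (Reg 0) (Const 1)) + 8))
     (for_c 2 (Add (Reg 0) (Const 1)) ?p) \<sigma> \<tau> \<and> I (Suc ?n) \<tau>"
  proof (rule for_runs)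
    show "I 0 (set_reg 2 0 \<sigma>)" using assms(1) by (simp add: I_def)
    show "val (Add (Reg 0) (Const 1)) \<tau> = Suc ?n" if "I v \<tau>" for v \<tau>
      using that by (simp add: I_def)
    fix v \<tau> assume v: "I v \<tau>" "reg \<tau> 2 = v"
    let ?\<tau> = "set_arr a (Suc v) (v * c + c) \<tau>"
    have "val e \<tau> = c" using v(1) by (intro e) (auto simp: I_def)
    moreover have "arr \<tau> a v = v * c" using v(1) by (simp add: I_def)
    ultimately have "runs (cost e + 7) ?p \<tau> ?\<tau>"
      using runs_Write[of "Add (Reg 2) (Const 1)" "Add (Read a (Reg 2)) e" a \<tau>] v(2)
      by (simp add: eval_nat_numeral)
    moreover have "I (Suc v) (set_reg 2 (Suc v) ?\<tau>)"
      using v(1) by (auto simp: I_def le_Suc_eq)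
    ultimately show "\<exists>\<tau>'. runs (cost e + 7) ?p \<tau> \<tau>' \<and> reg \<tau>' 2 = v \<and> I (Suc v) (set_reg 2 (Suc v) \<tau>')"
      using v(2) by (intro exI[of _ ?\<tau>]) simp
  qed
  then obtain \<tau> where \<tau>: "runs ((Suc ?n + 1) * (cost e + 7 + cost (Add (Reg 0) (Const 1)) + 8))
     (for_c 2 (Add (Reg 0) (Const 1)) ?p) \<sigma> \<tau>" "I (Suc ?n) \<tau>" by blast
  have "(Suc ?n + 1) * (cost e + 7 + cost (Add (Reg 0) (Const 1)) + 8) = (?n + 2) * (cost e + 18)"
    by simp
  then have "runs ((?n + 2) * (cost e + 18)) (multiples_c a e) \<sigma> \<tau>"
    using \<tau>(1) unfolding multiples_c_def by (simp only:)
  then show ?thesis using \<tau>(2) unfolding I_def by blast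
qed

section \<open>Codes of positions\<close>

primrec code :: "nat \<Rightarrow> nat list \<Rightarrow> nat" where
  "code b [] = 0"
| "code b (x # xs) = x + b * code b xs"

text \<open>The form in which a code is computed: one table lookup per digit, then a sum.\<close>

lemma code_eq_sum: "code b xs = (\<Sum>i\<leftarrow>[0..<length xs]. xs ! i * b ^ i)"
proof (induction xs)
  case (Cons x xs)
  have "(\<Sum>i\<leftarrow>[0..<length (x # xs)]. (x # xs) ! i * b ^ i) = x + (\<Sum>i\<leftarrow>[0..<length xs]. b * (xs ! i * b ^ i))"
    by (simp add: upt_rec[of 0] map_Suc_upt[symmetric] o_def mult.left_commute del: upt_Suc)
  then show ?case by (simp only: Cons.IH code.simps sum_list_const_mult)
qed simp

lemma code_inj:
  assumes "code b xs = code b ys" "length xs = length ys" "set xs \<subseteq> {..<b}" "set ys \<subseteq> {..<b}"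
  shows "xs = ys"
  using assms
proof (induction xs arbitrary: ys)
  case (Cons x xs)
  then obtain y zs where ys: "ys = y # zs" by (cases ys) auto
  have eq: "x + b * code b xs = y + b * code b zs" and lt: "x < b" "y < b"
    using Cons.prems ys by auto
  have "x = y" using arg_cong[OF eq, of "\<lambda>t. t mod b"] lt by simp
  moreover have "code b xs = code b zs" using eq lt \<open>x = y\<close> by simp
  ultimately show ?case using Cons.IH[of zs] Cons.prems ys by simp
qed simp

section \<open>The program\<close>

text \<open>
  Array 3 holds the multiples of \<open>n\<close>, array \<open>digit_a i\<close> those of \<open>(n + 1) ^ i\<close>; as there is no
  multiplication, codes and positions in the adjacency matrix are computed by table lookup.
  Cells 0 and 1 of array 4 record that some pair cannot be linked and that a routing of few pairs
  was found. The pebbles of a position are held in registers \<open>3, \<dots>, 2 + m\<close>, their targets in the next \<open>m\<close>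
  registers, and register \<open>3 + 2 * m\<close> holds the goal of a move.
\<close>

definition digit_a :: "nat \<Rightarrow> nat" where "digit_a i = 2 * i + 6"
definition good_a :: "nat \<Rightarrow> nat" where "good_a m = 2 * m + 5"

definition init_c :: "nat \<Rightarrow> com" where
  "init_c M = Seq (multiples_c 3 (Reg 0)) (Seq (multiples_c (digit_a 0) (Const 1))
     (seq_c (map (\<lambda>i. multiples_c (digit_a (Suc i)) (Read (digit_a i) (Add (Reg 0) (Const 1)))) [0..<M])))"

definition code_e :: "exp list \<Rightarrow> exp" where
  "code_e es = sum_e (map (\<lambda>i. Read (digit_a i) (es ! i)) [0..<length es])"

definition slot_e :: "nat \<Rightarrow> exp" where "slot_e i = Reg (3 + i)"

text \<open>The factor \<open>Sub (Reg 0) w\<close> tests \<open>w < n\<close>. It guards the lookup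
  of an arc: at \<open>w = n\<close> the index would fall into the next row of the adjacency
  matrix.\<close>

definition move_e :: "nat \<Rightarrow> nat \<Rightarrow> nat \<Rightarrow> exp" where
  "move_e m c i =
     (let w = slot_e (2 * m) in all_e
       [not_e (eq_e (slot_e i) (Reg 0)),
        Add (and_e (eq_e (slot_e i) (slot_e (m + i))) (eq_e w (Reg 0)))
          (and_e (Sub (Reg 0) w) (Read 0 (Add (Read 3 (slot_e i)) w))),
        all_e (map (\<lambda>j. Add (eq_e (slot_e j) (slot_e i)) (Add (eq_e (slot_e j) (Reg 0))
          (not_e (Read (good_a 1) (code_e [slot_e j, slot_e i]))))) [0..<m]),
        not_e (Sub (sum_e (map (\<lambda>j. eq_e (slot_e j) (slot_e i)) [0..<m])) (Const c)),
        Read (good_a m) (code_e ((map slot_e [0..<2 * m])[i := w]))])"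

definition guard_e :: "nat \<Rightarrow> nat \<Rightarrow> exp" where
  "guard_e m c = Add (all_e (map (\<lambda>i. eq_e (slot_e i) (Reg 0)) [0..<m])) (sum_e (map (move_e m c) [0..<m]))"

text \<open>The bound \<open>m * n + 1\<close> of \<open>level_stable\<close>, written as a repeated
  addition.\<close>

definition rounds_e :: "nat \<Rightarrow> exp" where
  "rounds_e m = Add (sum_e (replicate m (Reg 0))) (Const 1)"

definition game_c :: "nat \<Rightarrow> nat \<Rightarrow> com" where
  "game_c m c = for_c 2 (rounds_e m) (nest [3..<3 + (2 * m + 1)] (Add (Reg 0) (Const 1))
     (mark (guard_e m c) (good_a m) (code_e (map slot_e [0..<2 * m]))))"

definition unlinked_e :: exp where
  "unlinked_e = not_e (Read (good_a 1) (code_e [Read 1 (slot_e 0), Read 2 (slot_e 0)]))"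

definition link_c :: com where
  "link_c = nest [3] (Reg 1) (mark unlinked_e 4 (Const 0))"

definition found_e :: "nat \<Rightarrow> exp" where
  "found_e m = and_e
     (all_e (map (\<lambda>(i, j). not_e (eq_e (slot_e i) (slot_e j))) (filter (\<lambda>(i, j). i < j) (List.product [0..<m] [0..<m]))))
     (Read (good_a m) (code_e (map (\<lambda>i. Read 1 (slot_e i)) [0..<m] @ map (\<lambda>i. Read 2 (slot_e i)) [0..<m])))"

definition search_c :: "nat \<Rightarrow> com" where
  "search_c m = nest [3..<3 + m] (Reg 1) (mark (found_e m) 4 (Const 1))"

text \<open>Codes of positions with at most \<open>3 * d\<close> pebbles have at most
  \<open>6 * d\<close> digits, hence the argument of \<open>init_c\<close>. The game with one pebble
  comes first because all others use its table for reachability. The first summand of the answer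
  accepts the empty digraph.\<close>

definition routing_c :: "nat \<Rightarrow> com" where
  "routing_c d = Seq (init_c (6 * d)) (Seq (game_c 1 1) (Seq link_c
     (Seq (seq_c (map (\<lambda>m. Seq (game_c m (m - d)) (search_c m)) [Suc d..<Suc (3 * d)]))
       (Assign 0 (Add (eq_e (Reg 0) (Const 0))
          (and_e (not_e (Read 4 (Const 0))) (Read 4 (Const 1))))))))"

section \<open>Encoded instances and the intended contents of the arrays\<close>

locale routing_instance =
  fixes G :: "nat pair_pre_digraph" and ps :: "(nat \<times> nat) list"
  assumes inst: "acyclic_instance G ps"
begin

abbreviation n :: nat where "n \<equiv> card (pverts G)"
abbreviation k :: nat where "k \<equiv> length ps"

lemma verts: "pverts G = {..<n}"
  using inst by (simp add: acyclic_instance_def)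

end

text \<open>The number of vertices is the first number that is not a vertex. Taken as
  \<open>z\<close>, it makes positions tuples over \<open>{..n}\<close>, hence the base
  \<open>n + 1\<close> of the codes.\<close>

sublocale routing_instance \<subseteq> pebble_game G "card (pverts G)"
proof -
  interpret pair_digraph G using inst by (simp add: acyclic_instance_def)
  show "pebble_game G (card (pverts G))"
    by unfold_locales (use inst verts in \<open>auto simp: acyclic_instance_def\<close>)
qed

context routing_instance
begin

definition tables :: "nat \<Rightarrow> (nat \<Rightarrow> nat \<Rightarrow> nat) \<Rightarrow> bool" where
  "tables M A \<longleftrightarrow> (\<forall>u<n. \<forall>v<n. A 0 (u * n + v) \<noteq> 0 \<longleftrightarrow> (u, v) \<in> parcs G) \<and>
     (\<forall>j<k. A 1 j = fst (ps ! j) \<and> A 2 j = snd (ps ! j)) \<and>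
     (\<forall>v\<le>n. A 3 v = v * n) \<and> (\<forall>i<M. \<forall>v\<le>n. A (digit_a i) v = v * (n + 1) ^ i)"

definition correct :: "nat \<Rightarrow> nat \<Rightarrow> (nat \<Rightarrow> nat \<Rightarrow> nat) \<Rightarrow> bool" where
  "correct m c A \<longleftrightarrow> (\<forall>xs ts. length xs = m \<longrightarrow> length ts = m \<longrightarrow> set xs \<subseteq> {..n} \<longrightarrow> set ts \<subseteq> {..n} \<longrightarrow>
     (A (good_a m) (code (n + 1) (xs @ ts)) \<noteq> 0 \<longleftrightarrow> winning c xs ts))"

lemma tables_cong:
  assumes "tables M A" "\<And>a. a = 0 \<or> a = 1 \<or> a = 2 \<or> a = 3 \<or> a \<in> range digit_a \<Longrightarrow> B a = A a"
  shows "tables M B"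
  using assms by (simp add: tables_def)

lemma val_code_e:
  assumes "tables M (arr \<sigma>)" "length es \<le> M" "\<And>e. e \<in> set es \<Longrightarrow> val e \<sigma> \<le> n"
  shows "val (code_e es) \<sigma> = code (n + 1) (map (\<lambda>e. val e \<sigma>) es)"
proof -
  have "val (code_e es) \<sigma> = (\<Sum>i\<leftarrow>[0..<length es]. arr \<sigma> (digit_a i) (val (es ! i) \<sigma>))"
    by (simp add: code_e_def o_def)
  also have "\<dots> = (\<Sum>i\<leftarrow>[0..<length es]. val (es ! i) \<sigma> * (n + 1) ^ i)"
    using assms by (intro arg_cong[of _ _ sum_list] map_cong refl) (auto simp: tables_def)
  also have "\<dots> = code (n + 1) (map (\<lambda>e. val e \<sigma>) es)"
    unfolding code_eq_sum by (intro arg_cong[of _ _ sum_list] map_cong) auto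
  finally show ?thesis .
qed

lemma reach_less: "(u, v) \<in> (parcs G)\<^sup>* \<longleftrightarrow> winning 1 [u] [v]" if "u < n"
  using winning_single_iff[of u v] that verts by blast

lemma winning_final: "\<forall>x\<in>set xs. x = n \<Longrightarrow> winning c xs ts"
  unfolding winning_def by (intro exI[of _ 1]) simp

lemma winning_move:
  assumes "i < length xs" "move c xs ts i w" "winning c (xs[i := w]) ts"
  shows "winning c xs ts"
proof -
  obtain r where "(xs[i := w], ts) \<in> level c r" using assms(3) by (auto simp: winning_def)
  then have "(xs, ts) \<in> level c (Suc r)" using assms(1,2) by (subst level.simps) blast
  then show ?thesis unfolding winning_def by blast
qed

lemma arc_less: "(u, v) \<in> parcs G \<Longrightarrow> u < n \<and> v < n"
  using arc_fst_in_verts[of "(u, v)"] arc_snd_in_verts[of "(u, v)"] verts by (metis fst_conv snd_conv lessThan_iff)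

lemma move_goal: "move c xs ts i w \<Longrightarrow> w \<le> n"
  using arc_less[of "xs ! i" w] by (auto simp: move_def)

section \<open>Evaluation of the guard at a fixed position and goal\<close>

context
  fixes m c M :: nat and \<sigma> :: store and xs ts :: "nat list" and w :: nat
  assumes tab: "tables M (arr \<sigma>)" "2 * m \<le> M" "1 \<le> m"
    and reach: "m = 1 \<or> correct 1 1 (arr \<sigma>)"
    and r0: "reg \<sigma> 0 = n"
    and len: "length xs = m" "length ts = m"
    and le: "set xs \<subseteq> {..n}" "set ts \<subseteq> {..n}" "w \<le> n"
    and regs: "map (reg \<sigma>) [3..<3 + (2 * m + 1)] = xs @ ts @ [w]"
begin

lemma val_slot: "i < 2 * m + 1 \<Longrightarrow> val (slot_e i) \<sigma> = (xs @ ts @ [w]) ! i"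
  unfolding regs[symmetric] by (simp add: slot_e_def del: upt_Suc)

lemma val_slot_simps [simp]:
  "i < m \<Longrightarrow> val (slot_e i) \<sigma> = xs ! i" "i < m \<Longrightarrow> val (slot_e (m + i)) \<sigma> = ts ! i" "val (slot_e (2 * m)) \<sigma> = w"
  using val_slot[of i] val_slot[of "m + i"] val_slot[of "2 * m"] len by (auto simp: nth_append)

lemma map_val_slots: "map (\<lambda>e. val e \<sigma>) (map slot_e [0..<2 * m]) = xs @ ts"
  by (rule nth_equalityI) (use len val_slot in \<open>auto simp: nth_append\<close>)

lemma nth_le: "i < m \<Longrightarrow> xs ! i \<le> n" "i < m \<Longrightarrow> ts ! i \<le> n"
  using le len by (auto simp: subset_iff)

lemma val_code_position: "val (code_e (map slot_e [0..<2 * m])) \<sigma> = code (n + 1) (xs @ ts)"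
proof -
  have "val e \<sigma> \<le> n" if "e \<in> set (map slot_e [0..<2 * m])" for e
  proof -
    have "val e \<sigma> \<in> set (xs @ ts)" unfolding map_val_slots[symmetric] set_map[of "\<lambda>e. val e \<sigma>"] using that by (rule imageI)
    then show ?thesis using le by auto
  qed
  then show ?thesis using val_code_e[OF tab(1), of "map slot_e [0..<2 * m]"] tab(2) map_val_slots by simp
qed

lemma val_code_moved:
  assumes "i < m"
  shows "val (code_e ((map slot_e [0..<2 * m])[i := slot_e (2 * m)])) \<sigma> = code (n + 1) (xs[i := w] @ ts)"
proof -
  have map: "map (\<lambda>e. val e \<sigma>) ((map slot_e [0..<2 * m])[i := slot_e (2 * m)]) = xs[i := w] @ ts"
    unfolding map_update map_val_slots using assms len by (simp add: list_update_append)
  have "val e \<sigma> \<le> n" if "e \<in> set ((map slot_e [0..<2 * m])[i := slot_e (2 * m)])" for e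
  proof -
    have "val e \<sigma> \<in> set (xs[i := w] @ ts)" unfolding map[symmetric] set_map[of "\<lambda>e. val e \<sigma>"] using that by (rule imageI)
    then show ?thesis using le set_update_subset_insert[of xs i w] by auto
  qed
  then show ?thesis
    using val_code_e[OF tab(1), of "(map slot_e [0..<2 * m])[i := slot_e (2 * m)]"] tab(2) map by simp
qed

lemma val_code_pair:
  assumes "i < m" "j < m"
  shows "val (code_e [slot_e j, slot_e i]) \<sigma> = code (n + 1) [xs ! j, xs ! i]"
proof -
  have "val e \<sigma> \<le> n" if "e \<in> set [slot_e j, slot_e i]" for e
    using that assms nth_le by auto
  then show ?thesis using val_code_e[OF tab(1), of "[slot_e j, slot_e i]"] assms tab(2,3) by simp
qed

lemma val_move_e:
  assumes i: "i < m"
  shows "val (move_e m c i) \<sigma> \<noteq> 0 \<longleftrightarrow>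
    move c xs ts i w \<and> arr \<sigma> (good_a m) (code (n + 1) (xs[i := w] @ ts)) \<noteq> 0"
proof (cases "xs ! i = n")
  case True
  then show ?thesis using i r0 by (simp add: move_e_def Let_def move_def)
next
  case False
  then have x: "xs ! i < n" using nth_le(1)[OF i] by simp
  have "(w < n \<and> arr \<sigma> 0 (xs ! i * n + w) \<noteq> 0) \<longleftrightarrow> (xs ! i, w) \<in> parcs G"
  proof (cases "w < n")
    case True
    then show ?thesis using tab(1) x by (simp add: tables_def)
  next
    case False
    then have "(xs ! i, w) \<notin> parcs G" using arc_less by blast
    with False show ?thesis by simp
  qed
  moreover have "arr \<sigma> 3 (xs ! i) = xs ! i * n" using tab(1) x by (simp add: tables_def)
  ultimately have 1: "val (Add (and_e (eq_e (slot_e i) (slot_e (m + i))) (eq_e (slot_e (2 * m)) (Reg 0)))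
          (and_e (Sub (Reg 0) (slot_e (2 * m))) (Read 0 (Add (Read 3 (slot_e i)) (slot_e (2 * m)))))) \<sigma> \<noteq> 0
     \<longleftrightarrow> xs ! i = ts ! i \<and> w = n \<or> (xs ! i, w) \<in> parcs G"
    using i r0 by auto
  \<comment> \<open>For \<open>m = 1\<close> the first alternative always holds, so the answer does
    not depend on the table under construction. Two different vertices require two pebbles, and then
    the finished table for one pebble is available.\<close>
  have reach_entry: "xs ! j = xs ! i \<or> xs ! j = n \<or> arr \<sigma> (good_a 1) (code (n + 1) [xs ! j, xs ! i]) = 0 \<longleftrightarrow>
     xs ! j = xs ! i \<or> xs ! j = n \<or> (xs ! j, xs ! i) \<notin> (parcs G)\<^sup>*" if j: "j < m" for j
  proof (cases "xs ! j = xs ! i \<or> xs ! j = n")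
    case False
    then have "j \<noteq> i" "xs ! j < n" using nth_le(1)[OF j] by auto
    moreover from this have "correct 1 1 (arr \<sigma>)" using reach i j by auto
    ultimately have "arr \<sigma> (good_a 1) (code (n + 1) ([xs ! j] @ [xs ! i])) \<noteq> 0 \<longleftrightarrow> winning 1 [xs ! j] [xs ! i]"
      unfolding correct_def using x by (elim allE[of _ "[xs ! j]"] allE[of _ "[xs ! i]"]) auto
    then show ?thesis using reach_less[OF \<open>xs ! j < n\<close>] by auto
  qed auto
  define e where "e = (\<lambda>j. Add (eq_e (slot_e j) (slot_e i)) (Add (eq_e (slot_e j) (Reg 0))
      (not_e (Read (good_a 1) (code_e [slot_e j, slot_e i])))))"
  have "val (e j) \<sigma> \<noteq> 0 \<longleftrightarrow>
     xs ! j = xs ! i \<or> xs ! j = n \<or> arr \<sigma> (good_a 1) (code (n + 1) [xs ! j, xs ! i]) = 0" if "j < m" for j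
    using i r0 that by (simp add: e_def val_code_pair del: code.simps One_nat_def)
  then have "val (e j) \<sigma> \<noteq> 0 \<longleftrightarrow> xs ! j = xs ! i \<or> xs ! j = n \<or> (xs ! j, xs ! i) \<notin> (parcs G)\<^sup>*"
    if "j < m" for j
    using reach_entry that by blast
  then have 2: "val (all_e (map e [0..<m])) \<sigma> \<noteq> 0 \<longleftrightarrow>
     (\<forall>j<m. xs ! j = xs ! i \<or> xs ! j = n \<or> (xs ! j, xs ! i) \<notin> (parcs G)\<^sup>*)"
    by auto
  have "val (sum_e (map (\<lambda>j. eq_e (slot_e j) (slot_e i)) [0..<m])) \<sigma> = (\<Sum>j\<leftarrow>[0..<m]. if xs ! j = xs ! i then 1 else 0)"
    unfolding val_sum_e map_map by (intro arg_cong[of _ _ sum_list] map_cong) (use i in auto)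
  also have "\<dots> = (\<Sum>j\<in>{0..<m}. if xs ! j = xs ! i then 1 else 0)"
    by (simp add: interv_sum_list_conv_sum_set_nat)
  also have "\<dots> = card {j. j < m \<and> xs ! j = xs ! i}"
    by (simp add: sum.If_cases Collect_conj_eq lessThan_def atLeast0LessThan)
  finally have 3: "val (not_e (Sub (sum_e (map (\<lambda>j. eq_e (slot_e j) (slot_e i)) [0..<m])) (Const c))) \<sigma> \<noteq> 0 \<longleftrightarrow>
     card {j. j < m \<and> xs ! j = xs ! i} \<le> c"
    by simp
  have 4: "val (not_e (eq_e (slot_e i) (Reg 0))) \<sigma> \<noteq> 0" using i r0 False by simp
  have 5: "val (Read (good_a m) (code_e ((map slot_e [0..<2 * m])[i := slot_e (2 * m)]))) \<sigma> =
    arr \<sigma> (good_a m) (code (n + 1) (xs[i := w] @ ts))"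
    using val_code_moved[OF i] by simp
  have all5: "val (all_e [a, b, c, d, e]) \<sigma> \<noteq> 0 \<longleftrightarrow>
      val a \<sigma> \<noteq> 0 \<and> val b \<sigma> \<noteq> 0 \<and> val c \<sigma> \<noteq> 0 \<and> val d \<sigma> \<noteq> 0 \<and> val e \<sigma> \<noteq> 0" for a b c d e
    by simp
  have "val (move_e m c i) \<sigma> \<noteq> 0 \<longleftrightarrow> (xs ! i = ts ! i \<and> w = n \<or> (xs ! i, w) \<in> parcs G) \<and>
     (\<forall>j<m. xs ! j = xs ! i \<or> xs ! j = n \<or> (xs ! j, xs ! i) \<notin> (parcs G)\<^sup>*) \<and>
     card {j. j < m \<and> xs ! j = xs ! i} \<le> c \<and> arr \<sigma> (good_a m) (code (n + 1) (xs[i := w] @ ts)) \<noteq> 0"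
    unfolding move_e_def Let_def all5 1 2[unfolded e_def] 3 5 using 4 by blast
  then show ?thesis using False len unfolding move_def by blast
qed

lemma val_guard_e:
  "val (guard_e m c) \<sigma> \<noteq> 0 \<longleftrightarrow> (\<forall>x\<in>set xs. x = n) \<or>
     (\<exists>i<m. move c xs ts i w \<and> arr \<sigma> (good_a m) (code (n + 1) (xs[i := w] @ ts)) \<noteq> 0)"
proof -
  have "val (all_e (map (\<lambda>i. eq_e (slot_e i) (Reg 0)) [0..<m])) \<sigma> \<noteq> 0 \<longleftrightarrow> (\<forall>x\<in>set xs. x = n)"
    using r0 len by (auto simp: all_set_conv_all_nth)
  moreover have "val (sum_e (map (move_e m c) [0..<m])) \<sigma> \<noteq> 0 \<longleftrightarrow> (\<exists>i<m. val (move_e m c i) \<sigma> \<noteq> 0)"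
    by (auto simp del: not_gr_zero)
  ultimately show ?thesis unfolding guard_e_def using val_move_e by auto
qed

end

end

text \<open>The factor \<open>m + 1\<close> comes from
  \<open>m * n + 2 \<le> (m + 1) * (n + 2)\<close>, which bounds the rounds including the last test.
  Each of the \<open>2 * m + 1\<close> loops contributes 11, namely 3 for its bound
  \<open>n + 1\<close> and the 8 of \<open>for_runs\<close>.\<close>

definition game_const :: "nat \<Rightarrow> nat \<Rightarrow> nat" where
  "game_const m c = (m + 1) * (cost (guard_e m c) + cost (code_e (map slot_e [0..<2 * m])) + 3 +
     (2 * m + 1) * 11 + (cost (rounds_e m) + 8))"

definition search_const :: "nat \<Rightarrow> nat" where
  "search_const m = cost (found_e m) + 4 + m * 9"

lemma val_slot_e: "map (reg \<sigma>) [3..<3 + q] = ys \<Longrightarrow> i < q \<Longrightarrow> val (slot_e i) \<sigma> = ys ! i"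
  by (auto simp: slot_e_def)

section \<open>Correctness and time of the saturation, the search and the link test\<close>

context routing_instance
begin

lemma code_inj_le:
  assumes "code (n + 1) xs = code (n + 1) ys" "length xs = length ys" "set xs \<subseteq> {..n}" "set ys \<subseteq> {..n}"
  shows "xs = ys"
  using code_inj[OF assms(1,2)] assms(3,4) by (simp add: lessThan_Suc_atMost)

text \<open>Digit tables have even numbers from 6 on and position tables odd numbers from 5 on, so
  they avoid each other and the arrays 0 to 4.\<close>

lemma good_a_neq: "good_a m \<noteq> 0" "good_a m \<noteq> 1" "good_a m \<noteq> 2" "good_a m \<noteq> 3" "good_a m \<noteq> 4"
  "good_a m \<notin> range digit_a" "4 \<notin> range digit_a"
  by (auto simp: good_a_def digit_a_def) presburger+

lemma good_a_inj: "good_a m = good_a m' \<longleftrightarrow> m = m'"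
  by (auto simp: good_a_def)

lemma tables_good_a: "tables M A \<Longrightarrow> (\<And>a. a \<noteq> good_a m \<Longrightarrow> B a = A a) \<Longrightarrow> tables M B"
  using good_a_neq by (metis tables_cong)

lemma tables_flags: "tables M A \<Longrightarrow> (\<And>a. a \<noteq> 4 \<Longrightarrow> B a = A a) \<Longrightarrow> tables M B"
  by (rule tables_cong[of M A B]) (auto simp: digit_a_def)

lemma correct_cong: "B (good_a m) = A (good_a m) \<Longrightarrow> correct m c B \<longleftrightarrow> correct m c A"
  by (simp add: correct_def)

text \<open>Marks are read and written in one array, so a round may use marks made earlier in the
  same round and run ahead of the levels. The table is therefore bounded from two sides: whatever is
  marked is winning (\<open>J\<close>), and after \<open>v\<close> rounds at least
  \<open>level c v\<close> is marked (\<open>complete v\<close>). After \<open>m * n + 1\<close>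
  rounds the two bounds meet by \<open>level_stable\<close>.\<close>

lemma game_runs:
  assumes tab: "tables M (arr \<sigma>)" "2 * m \<le> M" "1 \<le> m"
    and reach: "m = 1 \<or> correct 1 1 (arr \<sigma>)"
    and r0: "reg \<sigma> 0 = n" and zero: "\<And>i. arr \<sigma> (good_a m) i = 0"
  shows "\<exists>\<tau>. runs (game_const m c * (n + 2) ^ (2 * m + 2)) (game_c m c) \<sigma> \<tau> \<and>
    reg \<tau> 0 = reg \<sigma> 0 \<and> reg \<tau> 1 = reg \<sigma> 1 \<and> (\<forall>a. a \<noteq> good_a m \<longrightarrow> arr \<tau> a = arr \<sigma> a) \<and>
    correct m c (arr \<tau>)"
proof -
  let ?g = "good_a m" and ?code = "code (n + 1)" and ?rs = "[3..<3 + (2 * m + 1)]"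
  let ?p = "mark (guard_e m c) ?g (code_e (map slot_e [0..<2 * m]))"
  let ?q = "nest ?rs (Add (Reg 0) (Const 1)) ?p"
  define valid where "valid xs ts \<longleftrightarrow> length xs = m \<and> length ts = m \<and> set xs \<subseteq> {..n} \<and> set ts \<subseteq> {..n}"
    for xs ts :: "nat list"
  define J where "J A \<longleftrightarrow> (\<forall>a. a \<noteq> ?g \<longrightarrow> A a = arr \<sigma> a) \<and>
    (\<forall>i. A ?g i \<noteq> 0 \<longrightarrow> (\<exists>xs ts. valid xs ts \<and> i = ?code (xs @ ts) \<and> winning c xs ts))" for A
  define complete where "complete r A \<longleftrightarrow>
    (\<forall>xs ts. valid xs ts \<longrightarrow> (xs, ts) \<in> level c r \<longrightarrow> A ?g (?code (xs @ ts)) \<noteq> 0)" for r and A :: "nat \<Rightarrow> nat \<Rightarrow> nat"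
  define I where "I v \<tau> \<longleftrightarrow> reg \<tau> 0 = n \<and> reg \<tau> 1 = reg \<sigma> 1 \<and> J (arr \<tau>) \<and> complete v (arr \<tau>)"
    for v and \<tau> :: store
  \<comment> \<open>\<open>J\<close> only says that some winning position has the marked code;
    injectivity of codes identifies it with the given position.\<close>
  have sound: "winning c xs ts" if a: "J A" "valid xs ts" "A ?g (?code (xs @ ts)) \<noteq> 0" for A xs ts
  proof -
    obtain xs' ts' where *: "valid xs' ts'" "?code (xs @ ts) = ?code (xs' @ ts')" "winning c xs' ts'"
      using a(1,3) unfolding J_def by blast
    have "xs @ ts = xs' @ ts'" using *(1,2) a(2) by (intro code_inj_le) (auto simp: valid_def)
    then show ?thesis using * a(2) by (auto simp: valid_def)
  qed
  have tabJ: "tables M A" if "J A" for A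
    using tables_good_a[OF tab(1)] that by (auto simp: J_def)
  have reachJ: "m = 1 \<or> correct 1 1 A" if "J A" for A
    using reach correct_cong[of A 1 "arr \<sigma>" 1] that good_a_inj[of 1 m] by (auto simp: J_def)
  have split: "\<exists>xs ts w. ys = xs @ ts @ [w] \<and> valid xs ts \<and> w \<le> n"
    if "length ys = length ?rs" "set ys \<subseteq> {..<n + 1}" for ys
  proof -
    have ys: "ys = take m ys @ take m (drop m ys) @ [ys ! (2 * m)]"
      using that(1) by (intro nth_equalityI) (auto simp: nth_append not_less less_Suc_eq)
    have le: "set (take m ys) \<subseteq> {..n}" "set (take m (drop m ys)) \<subseteq> {..n}" "ys ! (2 * m) \<le> n"
    proof -
      have le: "y \<le> n" if "y \<in> set ys" for y using subsetD[OF \<open>set ys \<subseteq> {..<n + 1}\<close> that] by simp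
      then show "set (take m ys) \<subseteq> {..n}" "set (take m (drop m ys)) \<subseteq> {..n}"
        by (auto dest: in_set_takeD in_set_dropD)
      show "ys ! (2 * m) \<le> n" by (rule le, rule nth_mem) (use that(1) in simp)
    qed
    show ?thesis
      by (rule exI[of _ "take m ys"], rule exI[of _ "take m (drop m ys)"], rule exI[of _ "ys ! (2 * m)"])
        (use ys le that(1) in \<open>auto simp: valid_def\<close>)
  qed
  let ?t1 = "cost (guard_e m c) + cost (code_e (map slot_e [0..<2 * m])) + 3 + (2 * m + 1) * 11"
  have "\<exists>\<tau>. runs ((m * n + 1 + 1) * ((n + 2) ^ (2 * m + 1) * ?t1 + cost (rounds_e m) + 8)) (game_c m c) \<sigma> \<tau> \<and> I (m * n + 1) \<tau>"
    unfolding game_c_def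
  proof (rule for_runs)
    show "I 0 (set_reg 2 0 \<sigma>)" using r0 zero by (auto simp: I_def J_def complete_def)
    show "val (rounds_e m) \<tau> = m * n + 1" if "I v \<tau>" for v \<tau>
      using that by (simp add: I_def rounds_e_def sum_list_replicate)
    fix v \<tau> assume v: "I v \<tau>" "reg \<tau> 2 = v"
    define F where "F ys = ?code (take (2 * m) ys)" for ys :: "nat list"
    \<comment> \<open>The last entry \<open>w\<close> guesses the goal of a move. A position is
      marked as soon as one of its extensions by a goal makes the guard true.\<close>
    define \<Phi> where "\<Phi> ys \<longleftrightarrow> (\<exists>xs ts w. ys = xs @ ts @ [w] \<and> valid xs ts \<and> w \<le> n \<and>
      ((\<forall>x\<in>set xs. x = n) \<or> (\<exists>i<m. move c xs ts i w \<and> (xs[i := w], ts) \<in> level c v)))" for ys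
    have F: "F (xs @ ts @ [w]) = ?code (xs @ ts)" if "valid xs ts" for xs ts w
      using that by (simp add: F_def valid_def)
    have upd: "valid (xs[i := w]) ts" if "valid xs ts" "w \<le> n" for xs ts i w
      using that set_update_subset_insert[of xs i w] by (auto simp: valid_def)
    have regs0: "reg \<rho> 0 = n" if "\<forall>r. r \<notin> set ?rs \<longrightarrow> reg \<rho> r = reg \<tau> r" for \<rho> :: store
      using that v(1) by (simp add: I_def)
    have "\<exists>\<tau>'. runs ((n + 1 + 1) ^ length ?rs * (cost (guard_e m c) + cost (code_e (map slot_e [0..<2 * m])) + 3 +
          length ?rs * (cost (Add (Reg 0) (Const 1)) + 8))) ?q \<tau> \<tau>' \<and>
      (\<forall>r. r \<notin> set ?rs \<longrightarrow> reg \<tau>' r = reg \<tau> r) \<and> (J (arr \<tau>') \<and> complete v (arr \<tau>')) \<and>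
      (\<forall>ys. length ys = length ?rs \<longrightarrow> set ys \<subseteq> {..<n + 1} \<longrightarrow> \<Phi> ys \<longrightarrow> arr \<tau>' ?g (F ys) \<noteq> 0)"
    \<comment> \<open>The invariant of the sweep includes \<open>complete v\<close>, since the guard
      relies on the marks of earlier rounds at every tuple.\<close>
    proof (rule nest_mark[where J = "\<lambda>A. J A \<and> complete v A"])
      show "distinct ?rs" by simp
      show "val (Add (Reg 0) (Const 1)) \<rho> = n + 1" if "\<forall>r. r \<notin> set ?rs \<longrightarrow> reg \<rho> r = reg \<tau> r" for \<rho>
        using regs0[OF that] by simp
      show "\<forall>r. r \<notin> set ?rs \<longrightarrow> reg \<tau> r = reg \<tau> r" "J (arr \<tau>) \<and> complete v (arr \<tau>)"
        using v(1) by (simp_all add: I_def)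
      fix ys and \<rho> :: store
      assume ys: "length ys = length ?rs" "set ys \<subseteq> {..<n + 1}" and rs: "map (reg \<rho>) ?rs = ys"
        and \<rho>: "\<forall>r. r \<notin> set ?rs \<longrightarrow> reg \<rho> r = reg \<tau> r" and A: "J (arr \<rho>) \<and> complete v (arr \<rho>)"
      obtain xs ts w where xs: "ys = xs @ ts @ [w]" "valid xs ts" "w \<le> n" using split[OF ys] by blast
      have len: "length xs = m" "length ts = m" and le: "set xs \<subseteq> {..n}" "set ts \<subseteq> {..n}"
        using xs(2) by (auto simp: valid_def)
      note ctx = tabJ[OF conjunct1[OF A]] tab(2,3) reachJ[OF conjunct1[OF A]] regs0[OF \<rho>] len le xs(3) rs[unfolded xs(1)]
      have val: "val (code_e (map slot_e [0..<2 * m])) \<rho> = ?code (xs @ ts)"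
        using val_code_position[OF ctx] .
      then show "val (code_e (map slot_e [0..<2 * m])) \<rho> = F ys" using F[OF xs(2)] xs(1) by simp
      note guard = val_guard_e[OF ctx, of c]
      show "val (guard_e m c) \<rho> \<noteq> 0" if "\<Phi> ys"
      proof -
        have "(\<forall>x\<in>set xs. x = n) \<or> (\<exists>i<m. move c xs ts i w \<and> (xs[i := w], ts) \<in> level c v)"
          using that len unfolding \<Phi>_def xs(1) by (auto simp: valid_def)
        then show ?thesis unfolding guard using A upd[OF xs(2,3)] by (auto simp: complete_def)
      qed
      show "J ((arr \<rho>)(?g := (arr \<rho> ?g)(F ys := 1))) \<and> complete v ((arr \<rho>)(?g := (arr \<rho> ?g)(F ys := 1)))"
        if "val (guard_e m c) \<rho> \<noteq> 0"
      proof -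
        have "winning c xs ts"
          using that[unfolded guard] winning_final winning_move[of _ xs c ts w] sound[of "arr \<rho>" _ ts] A upd[OF xs(2,3)] len
          by blast
        then have "\<exists>xs ts. valid xs ts \<and> F ys = ?code (xs @ ts) \<and> winning c xs ts"
          using F[OF xs(2)] xs by blast
        then show ?thesis using A by (auto simp: J_def complete_def)
      qed
    qed
    then obtain \<tau>' where \<tau>': "runs ((n + 1 + 1) ^ length ?rs * (cost (guard_e m c) + cost (code_e (map slot_e [0..<2 * m])) + 3 +
          length ?rs * (cost (Add (Reg 0) (Const 1)) + 8))) ?q \<tau> \<tau>'"
      "\<forall>r. r \<notin> set ?rs \<longrightarrow> reg \<tau>' r = reg \<tau> r" "J (arr \<tau>')"
      "\<And>ys. length ys = length ?rs \<Longrightarrow> set ys \<subseteq> {..<n + 1} \<Longrightarrow> \<Phi> ys \<Longrightarrow> arr \<tau>' ?g (F ys) \<noteq> 0"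
      by blast
    have "complete (Suc v) (arr \<tau>')"
      unfolding complete_def
    proof (intro allI impI)
      fix xs ts assume val: "valid xs ts" and lev: "(xs, ts) \<in> level c (Suc v)"
      \<comment> \<open>A position without pebbles on the digraph admits no move, but its guard is
        true for every goal, so any \<open>w\<close> is a witness.\<close>
      have "\<exists>w\<le>n. (\<forall>x\<in>set xs. x = n) \<or> (\<exists>i<m. move c xs ts i w \<and> (xs[i := w], ts) \<in> level c v)"
      proof (cases "\<forall>x\<in>set xs. x = n")
        case False
        then obtain i w where "i < m" "move c xs ts i w" "(xs[i := w], ts) \<in> level c v"
          using lev val by (auto simp: valid_def)
        then show ?thesis using move_goal by blast
      qed auto
      then obtain w where w: "w \<le> n" "\<Phi> (xs @ ts @ [w])" using val unfolding \<Phi>_def by blast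
      have "arr \<tau>' ?g (F (xs @ ts @ [w])) \<noteq> 0"
      proof (rule \<tau>'(4)[OF _ _ w(2)])
        show "set (xs @ ts @ [w]) \<subseteq> {..<n + 1}"
          using val w(1) by (auto simp: valid_def lessThan_Suc_atMost)
      qed (use val in \<open>simp add: valid_def\<close>)
      then show "arr \<tau>' ?g (?code (xs @ ts)) \<noteq> 0" using F[OF val] by simp
    qed
    then have "I (Suc v) (set_reg 2 (Suc v) \<tau>')"
      using \<tau>'(2,3) v(1) by (simp add: I_def)
    moreover have "reg \<tau>' 2 = v" using \<tau>'(2) v(2) by simp
    moreover have "runs ((n + 2) ^ (2 * m + 1) * ?t1) ?q \<tau> \<tau>'"
      by (rule runs_mono[OF \<tau>'(1)]) simp
    ultimately show "\<exists>\<tau>'. runs ((n + 2) ^ (2 * m + 1) * ?t1) ?q \<tau> \<tau>' \<and> reg \<tau>' 2 = v \<and>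
        I (Suc v) (set_reg 2 (Suc v) \<tau>')"
      by blast
  qed
  then obtain \<tau> where \<tau>: "runs ((m * n + 1 + 1) * ((n + 2) ^ (2 * m + 1) * ?t1 + cost (rounds_e m) + 8)) (game_c m c) \<sigma> \<tau>"
    "I (m * n + 1) \<tau>" by blast
  have "(m * n + 1 + 1) * ((n + 2) ^ (2 * m + 1) * ?t1 + cost (rounds_e m) + 8) \<le>
      ((m + 1) * (n + 2)) * ((n + 2) ^ (2 * m + 1) * (?t1 + (cost (rounds_e m) + 8)))"
  proof (intro mult_le_mono)
    have "1 * (cost (rounds_e m) + 8) \<le> (n + 2) ^ (2 * m + 1) * (cost (rounds_e m) + 8)"
      by (intro mult_le_mono1 one_le_power) simp
    then show "(n + 2) ^ (2 * m + 1) * ?t1 + cost (rounds_e m) + 8 \<le>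
        (n + 2) ^ (2 * m + 1) * (?t1 + (cost (rounds_e m) + 8))"
      unfolding add_mult_distrib2 by linarith
  qed (simp add: algebra_simps)
  also have "\<dots> = game_const m c * (n + 2) ^ (2 * m + 2)"
  proof -
    have "(n + 2) ^ (2 * m + 2) = (n + 2) * (n + 2) ^ (2 * m + 1)" by simp
    then show ?thesis unfolding game_const_def by (simp only: mult_ac)
  qed
  finally have "runs (game_const m c * (n + 2) ^ (2 * m + 2)) (game_c m c) \<sigma> \<tau>"
    using \<tau>(1) runs_mono by blast
  moreover have "correct m c (arr \<tau>)"
    unfolding correct_def
  proof (intro allI impI)
    fix xs ts :: "nat list"
    assume "length xs = m" "length ts = m" "set xs \<subseteq> {..n}" "set ts \<subseteq> {..n}"
    then have val: "valid xs ts" by (simp add: valid_def)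
    have "(xs, ts) \<in> level c (m * n + 1)" if win: "winning c xs ts"
    proof -
      obtain r where "(xs, ts) \<in> level c r" using win unfolding winning_def by blast
      moreover have "set xs \<subseteq> insert n (pverts G)" using val by (subst verts) (auto simp: valid_def)
      ultimately show ?thesis using level_stable[of xs ts c r] val by (simp add: valid_def)
    qed
    then show "arr \<tau> ?g (?code (xs @ ts)) \<noteq> 0 \<longleftrightarrow> winning c xs ts"
      using \<tau>(2) val sound unfolding I_def complete_def by blast
  qed
  ultimately show ?thesis using \<tau>(2) r0 by (auto simp: I_def J_def)
qed

lemma pair_le: "j < k \<Longrightarrow> fst (ps ! j) < n \<and> snd (ps ! j) < n"
proof -
  assume "j < k"
  then have "ps ! j \<in> pverts G \<times> pverts G"
    using inst nth_mem unfolding acyclic_instance_def by blast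
  then show ?thesis using verts by (metis lessThan_iff mem_Times_iff)
qed

text \<open>The pairs are distinct. Through this bound a search over all index tuples costs a power
  of \<open>n\<close> whose exponent is independent of \<open>k\<close>.\<close>

lemma k_le: "k \<le> n * n"
proof -
  have "k = card (set ps)" using inst distinct_card unfolding acyclic_instance_def by metis
  also have "\<dots> \<le> card (pverts G \<times> pverts G)"
    using inst pair_finite_verts unfolding acyclic_instance_def by (intro card_mono) auto
  finally show ?thesis by (simp add: card_cartesian_product)
qed

lemma k_pow_le: "(k + 1) ^ m \<le> (n + 2) ^ (2 * m)"
proof -
  have "k + 1 \<le> (n + 2)\<^sup>2" using k_le by (simp add: power2_eq_square)
  then show ?thesis unfolding power_mult by (rule power_mono) simp
qed

text \<open>The guard reads no array that the search writes, so, unlike in the game, its value is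
  known exactly. The flag is shared by the searches for all \<open>m\<close>, hence its earlier
  value in the conclusion.\<close>

lemma search_runs:
  assumes tab: "tables M (arr \<sigma>)" "2 * m \<le> M"
    and corr: "correct m c (arr \<sigma>)" and r0: "reg \<sigma> 0 = n" "reg \<sigma> 1 = k"
  shows "\<exists>\<tau>. runs (search_const m * (n + 2) ^ (2 * m)) (search_c m) \<sigma> \<tau> \<and>
    reg \<tau> 0 = n \<and> reg \<tau> 1 = k \<and> (\<forall>a. a \<noteq> 4 \<longrightarrow> arr \<tau> a = arr \<sigma> a) \<and> arr \<tau> 4 0 = arr \<sigma> 4 0 \<and>
    (arr \<tau> 4 1 \<noteq> 0 \<longleftrightarrow> arr \<sigma> 4 1 \<noteq> 0 \<or> (\<exists>js. length js = m \<and> distinct js \<and> set js \<subseteq> {..<k} \<and>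
       winning c (map fst (select ps js)) (map snd (select ps js))))"
proof -
  let ?rs = "[3..<3 + m]"
  define found where "found js \<longleftrightarrow> length js = m \<and> distinct js \<and> set js \<subseteq> {..<k} \<and>
       winning c (map fst (select ps js)) (map snd (select ps js))" for js
  define J where "J A \<longleftrightarrow> (\<forall>a. a \<noteq> 4 \<longrightarrow> A a = arr \<sigma> a) \<and> A 4 0 = arr \<sigma> 4 0 \<and>
    (A 4 1 \<noteq> 0 \<longrightarrow> arr \<sigma> 4 1 \<noteq> 0 \<or> Ex found) \<and> (arr \<sigma> 4 1 \<noteq> 0 \<longrightarrow> A 4 1 \<noteq> 0)" for A
  have val: "val (found_e m) \<rho> \<noteq> 0 \<longleftrightarrow> found ys"
    if ys: "length ys = length ?rs" "set ys \<subseteq> {..<k}" "map (reg \<rho>) ?rs = ys" and J: "J (arr \<rho>)" for ys \<rho>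
  proof -
    have slots: "val (slot_e i) \<rho> = ys ! i" if "i < m" for i using val_slot_e[OF ys(3)] that by simp
    have len: "length ys = m" using ys(1) by simp
    have less: "ys ! i < k" if "i < m" for i using subsetD[OF ys(2) nth_mem[of i ys]] len that by simp
    have dist: "val (all_e (map (\<lambda>(i, j). not_e (eq_e (slot_e i) (slot_e j)))
        (filter (\<lambda>(i, j). i < j) (List.product [0..<m] [0..<m])))) \<rho> \<noteq> 0 \<longleftrightarrow> distinct ys" (is "?l \<longleftrightarrow> _")
    proof -
      have "?l \<longleftrightarrow> (\<forall>i<m. \<forall>j<m. i < j \<longrightarrow> ys ! i \<noteq> ys ! j)"
        using slots by auto
      also have "\<dots> \<longleftrightarrow> distinct ys"
        unfolding distinct_conv_nth len using linorder_neqE_nat by (intro iffI allI impI) (metis, blast)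
      finally show ?thesis .
    qed
    have tabs: "tables M (arr \<rho>)" using tables_flags[OF tab(1)] J by (simp add: J_def)
    have corrs: "correct m c (arr \<rho>)"
      using corr J good_a_neq(5)[of m] correct_cong[of "arr \<rho>" m "arr \<sigma>" c] by (simp add: J_def)
    let ?es = "map (\<lambda>i. Read 1 (slot_e i)) [0..<m] @ map (\<lambda>i. Read 2 (slot_e i)) [0..<m]"
    have vals: "map (\<lambda>e. val e \<rho>) ?es = map fst (select ps ys) @ map snd (select ps ys)"
      unfolding map_append
    proof (intro arg_cong2[of _ _ _ _ append])
      show "map (\<lambda>e. val e \<rho>) (map (\<lambda>i. Read 1 (slot_e i)) [0..<m]) = map fst (select ps ys)"
        using tabs slots less len by (intro nth_equalityI) (auto simp: select_def tables_def)
      show "map (\<lambda>e. val e \<rho>) (map (\<lambda>i. Read 2 (slot_e i)) [0..<m]) = map snd (select ps ys)"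
        using tabs slots less len by (intro nth_equalityI) (auto simp: select_def tables_def)
    qed
    have le: "set (map fst (select ps ys)) \<subseteq> {..n}" "set (map snd (select ps ys)) \<subseteq> {..n}"
      using ys(2) pair_le by (fastforce simp: select_def)+
    have "val e \<rho> \<le> n" if "e \<in> set ?es" for e
    proof -
      have "val e \<rho> \<in> set (map (\<lambda>e. val e \<rho>) ?es)"
        unfolding set_map[of "\<lambda>e. val e \<rho>"] using that by (rule imageI)
      then show ?thesis unfolding vals using le by auto
    qed
    then have "val (code_e ?es) \<rho> = code (n + 1) (map fst (select ps ys) @ map snd (select ps ys))"
      using val_code_e[OF tabs, of ?es] tab(2) vals by simp
    moreover have "arr \<rho> (good_a m) (code (n + 1) (map fst (select ps ys) @ map snd (select ps ys))) \<noteq> 0 \<longleftrightarrow>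
        winning c (map fst (select ps ys)) (map snd (select ps ys))"
      using corrs le len unfolding correct_def by (simp add: select_def)
    ultimately have "val (Read (good_a m) (code_e ?es)) \<rho> \<noteq> 0 \<longleftrightarrow>
        winning c (map fst (select ps ys)) (map snd (select ps ys))" by simp
    then show ?thesis
      unfolding found_e_def val_and_e found_def using dist len ys(2) by simp
  qed
  have "\<exists>\<tau>. runs ((k + 1) ^ length ?rs * (cost (found_e m) + cost (Const 1) + 3 + length ?rs * (cost (Reg 1) + 8)))
      (search_c m) \<sigma> \<tau> \<and> (\<forall>r. r \<notin> set ?rs \<longrightarrow> reg \<tau> r = reg \<sigma> r) \<and> J (arr \<tau>) \<and>
      (\<forall>ys. length ys = length ?rs \<longrightarrow> set ys \<subseteq> {..<k} \<longrightarrow> found ys \<longrightarrow> arr \<tau> 4 1 \<noteq> 0)"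
    unfolding search_c_def
  proof (rule nest_mark[where F = "\<lambda>_. 1"])
    show "val (Reg 1) \<rho> = k" if "\<forall>r. r \<notin> set ?rs \<longrightarrow> reg \<rho> r = reg \<sigma> r" for \<rho>
      using that r0 by simp
    fix ys and \<rho> :: store
    assume ys: "length ys = length ?rs" "set ys \<subseteq> {..<k}" "map (reg \<rho>) ?rs = ys" and A: "J (arr \<rho>)"
    show "val (found_e m) \<rho> \<noteq> 0" if "found ys" using val[OF ys A] that by simp
    show "J ((arr \<rho>)(4 := (arr \<rho> 4)(1 := 1)))" if "val (found_e m) \<rho> \<noteq> 0"
      using A val[OF ys A] that by (auto simp: J_def)
  qed (auto simp: J_def)
  then obtain \<tau> where \<tau>: "runs ((k + 1) ^ length ?rs * (cost (found_e m) + cost (Const 1) + 3 +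
      length ?rs * (cost (Reg 1) + 8))) (search_c m) \<sigma> \<tau>"
    "\<forall>r. r \<notin> set ?rs \<longrightarrow> reg \<tau> r = reg \<sigma> r" "J (arr \<tau>)"
    "\<And>ys. length ys = length ?rs \<Longrightarrow> set ys \<subseteq> {..<k} \<Longrightarrow> found ys \<Longrightarrow> arr \<tau> 4 1 \<noteq> 0"
    by blast
  have "(k + 1) ^ length ?rs * (cost (found_e m) + cost (Const 1) + 3 + length ?rs * (cost (Reg 1) + 8)) =
      search_const m * (k + 1) ^ m"
    by (simp add: search_const_def)
  also have "\<dots> \<le> search_const m * (n + 2) ^ (2 * m)" by (intro mult_le_mono2 k_pow_le)
  finally have "runs (search_const m * (n + 2) ^ (2 * m)) (search_c m) \<sigma> \<tau>"
    by (rule runs_mono[OF \<tau>(1)])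
  moreover have "arr \<tau> 4 1 \<noteq> 0" if "found ys" for ys
    using \<tau>(4)[of ys] that by (simp add: found_def)
  then have "arr \<tau> 4 1 \<noteq> 0 \<longleftrightarrow> arr \<sigma> 4 1 \<noteq> 0 \<or> Ex found"
    using \<tau>(3) unfolding J_def by blast
  ultimately show ?thesis using \<tau>(2,3) r0 unfolding found_def J_def by auto
qed

lemma link_runs:
  assumes tab: "tables M (arr \<sigma>)" "2 \<le> M"
    and corr: "correct 1 1 (arr \<sigma>)" and r0: "reg \<sigma> 0 = n" "reg \<sigma> 1 = k" and zero: "arr \<sigma> 4 0 = 0"
  shows "\<exists>\<tau>. runs ((cost unlinked_e + 13) * (n + 2) ^ 2) link_c \<sigma> \<tau> \<and>
    reg \<tau> 0 = n \<and> reg \<tau> 1 = k \<and> (\<forall>a. a \<noteq> 4 \<longrightarrow> arr \<tau> a = arr \<sigma> a) \<and> arr \<tau> 4 1 = arr \<sigma> 4 1 \<and>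
    (arr \<tau> 4 0 = 0 \<longleftrightarrow> (\<forall>(s, t)\<in>set ps. winning 1 [s] [t]))"
proof -
  define bad where "bad j \<longleftrightarrow> \<not> winning 1 [fst (ps ! j)] [snd (ps ! j)]" for j
  define J where "J A \<longleftrightarrow> (\<forall>a. a \<noteq> 4 \<longrightarrow> A a = arr \<sigma> a) \<and> A 4 1 = arr \<sigma> 4 1 \<and>
    (A 4 0 \<noteq> 0 \<longrightarrow> (\<exists>j<k. bad j))" for A
  have val: "val unlinked_e \<rho> \<noteq> 0 \<longleftrightarrow> bad (hd ys)"
    if ys: "length ys = length [3::nat]" "set ys \<subseteq> {..<k}" "map (reg \<rho>) [3] = ys" and J: "J (arr \<rho>)" for ys \<rho>
  proof -
    let ?j = "hd ys"
    have j: "?j < k" "val (slot_e 0) \<rho> = ?j" using ys by (auto simp: slot_e_def)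
    have tabs: "tables M (arr \<rho>)" using tables_flags[OF tab(1)] J by (simp add: J_def)
    have corrs: "correct 1 1 (arr \<rho>)"
      using corr J good_a_neq(5)[of 1] correct_cong[of "arr \<rho>" 1 "arr \<sigma>" 1] by (simp add: J_def)
    let ?es = "[Read 1 (slot_e 0), Read 2 (slot_e 0)]"
    have vals: "map (\<lambda>e. val e \<rho>) ?es = [fst (ps ! ?j)] @ [snd (ps ! ?j)]"
      using tabs j by (simp add: tables_def)
    have "val e \<rho> \<le> n" if "e \<in> set ?es" for e
      using that vals pair_le[OF j(1)] by auto
    then have "val (code_e ?es) \<rho> = code (n + 1) ([fst (ps ! ?j)] @ [snd (ps ! ?j)])"
      using val_code_e[OF tabs, of ?es] tab(2) unfolding vals by simp
    moreover have "arr \<rho> (good_a 1) (code (n + 1) ([fst (ps ! ?j)] @ [snd (ps ! ?j)])) \<noteq> 0 \<longleftrightarrow>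
        winning 1 [fst (ps ! ?j)] [snd (ps ! ?j)]"
      using corrs pair_le[OF j(1)] unfolding correct_def
      by (elim allE[of _ "[fst (ps ! ?j)]"] allE[of _ "[snd (ps ! ?j)]"]) auto
    ultimately show ?thesis unfolding unlinked_e_def bad_def by (auto simp del: code.simps)
  qed
  have "\<exists>\<tau>. runs ((k + 1) ^ length [3::nat] * (cost unlinked_e + cost (Const 0) + 3 + length [3::nat] * (cost (Reg 1) + 8)))
      link_c \<sigma> \<tau> \<and> (\<forall>r. r \<notin> set [3::nat] \<longrightarrow> reg \<tau> r = reg \<sigma> r) \<and> J (arr \<tau>) \<and>
      (\<forall>ys. length ys = length [3::nat] \<longrightarrow> set ys \<subseteq> {..<k} \<longrightarrow> bad (hd ys) \<longrightarrow> arr \<tau> 4 0 \<noteq> 0)"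
    unfolding link_c_def
  proof (rule nest_mark[where F = "\<lambda>_. 0"])
    show "val (Reg 1) \<rho> = k" if "\<forall>r. r \<notin> set [3::nat] \<longrightarrow> reg \<rho> r = reg \<sigma> r" for \<rho>
      using that r0 by simp
    fix ys and \<rho> :: store
    assume ys: "length ys = length [3::nat]" "set ys \<subseteq> {..<k}" "map (reg \<rho>) [3] = ys" and A: "J (arr \<rho>)"
    show "val unlinked_e \<rho> \<noteq> 0" if "bad (hd ys)" using val[OF ys A] that by simp
    have "hd ys < k" using ys(1,2) by (cases ys) auto
    then show "J ((arr \<rho>)(4 := (arr \<rho> 4)(0 := 1)))" if "val unlinked_e \<rho> \<noteq> 0"
      using A val[OF ys A] that by (auto simp: J_def)
  qed (use zero in \<open>auto simp: J_def\<close>)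
  then obtain \<tau> where \<tau>: "runs ((k + 1) ^ 1 * (cost unlinked_e + 13)) link_c \<sigma> \<tau>"
    "\<forall>r. r \<noteq> 3 \<longrightarrow> reg \<tau> r = reg \<sigma> r" "J (arr \<tau>)"
    "\<And>ys. length ys = length [3::nat] \<Longrightarrow> set ys \<subseteq> {..<k} \<Longrightarrow> bad (hd ys) \<Longrightarrow> arr \<tau> 4 0 \<noteq> 0"
    by (auto simp: eval_nat_numeral)
  have "runs ((cost unlinked_e + 13) * (n + 2) ^ 2) link_c \<sigma> \<tau>"
    by (rule runs_mono[OF \<tau>(1)]) (use mult_le_mono2[OF k_pow_le[of 1], of "cost unlinked_e + 13"] in \<open>simp only: mult.commute mult_1_left mult_1_right\<close>)
  moreover have "arr \<tau> 4 0 \<noteq> 0" if "j < k" "bad j" for j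
    using \<tau>(4)[of "[j]"] that by simp
  then have "arr \<tau> 4 0 = 0 \<longleftrightarrow> (\<forall>j<k. \<not> bad j)" using \<tau>(3) unfolding J_def by blast
  then have "arr \<tau> 4 0 = 0 \<longleftrightarrow> (\<forall>(s, t)\<in>set ps. winning 1 [s] [t])"
    by (simp add: bad_def all_set_conv_all_nth case_prod_unfold)
  ultimately show ?thesis using \<tau>(2,3) r0 by (auto simp: J_def)
qed

end

text \<open>A table costs at most \<open>22 * (n + 2)\<close> steps, and 23 also absorbs one step of
  sequencing once everything is measured by the same power of \<open>n + 2\<close>. Each stage
  receives 2 extra steps for sequencing; 40 covers the final assignment and the remaining single
  steps.\<close>

definition total_const :: "nat \<Rightarrow> nat" where
  "total_const d = (6 * d + 2) * 23 + game_const 1 1 + (cost unlinked_e + 13) +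
     (\<Sum>m\<leftarrow>[Suc d..<Suc (3 * d)]. game_const m (m - d) + search_const m + 2) + 40"

section \<open>Assembly of the program\<close>

context routing_instance
begin

lemma multiples_table:
  assumes "reg \<sigma> 0 = n" "arr \<sigma> a 0 = 0" "cost e \<le> 4"
    and "\<And>\<tau>. reg \<tau> 0 = n \<Longrightarrow> \<forall>b. b \<noteq> a \<longrightarrow> arr \<tau> b = arr \<sigma> b \<Longrightarrow> val e \<tau> = c"
  shows "\<exists>\<tau>. runs (22 * (n + 2)) (multiples_c a e) \<sigma> \<tau> \<and>
    reg \<tau> 0 = n \<and> reg \<tau> 1 = reg \<sigma> 1 \<and> (\<forall>b. b \<noteq> a \<longrightarrow> arr \<tau> b = arr \<sigma> b) \<and> (\<forall>v\<le>Suc n. arr \<tau> a v = v * c)"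
proof -
  have "\<exists>\<tau>. runs ((reg \<sigma> 0 + 2) * (cost e + 18)) (multiples_c a e) \<sigma> \<tau> \<and>
    (\<forall>r. r \<noteq> 2 \<longrightarrow> reg \<tau> r = reg \<sigma> r) \<and> (\<forall>b. b \<noteq> a \<longrightarrow> arr \<tau> b = arr \<sigma> b) \<and>
    (\<forall>v\<le>Suc (reg \<sigma> 0). arr \<tau> a v = v * c)"
    by (rule multiples_runs) (use assms(1,2) in \<open>auto intro!: assms(4)\<close>)
  then obtain \<tau> where \<tau>: "runs ((n + 2) * (cost e + 18)) (multiples_c a e) \<sigma> \<tau>"
    "\<forall>r. r \<noteq> 2 \<longrightarrow> reg \<tau> r = reg \<sigma> r" "\<forall>b. b \<noteq> a \<longrightarrow> arr \<tau> b = arr \<sigma> b" "\<forall>v\<le>Suc n. arr \<tau> a v = v * c"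
    unfolding assms(1) by blast
  have "(n + 2) * (cost e + 18) \<le> (n + 2) * 22" using assms(3) by (intro mult_le_mono2) simp
  with \<tau>(1) have "runs (22 * (n + 2)) (multiples_c a e) \<sigma> \<tau>"
    by (metis mult.commute runs_mono)
  with \<tau> assms(1) show ?thesis by (intro exI[of _ \<tau>]) simp
qed

lemma init_runs:
  "\<exists>\<tau>. runs ((M + 2) * (22 * (n + 2) + 1) + 1) (init_c M) (input G ps) \<tau> \<and>
    reg \<tau> 0 = n \<and> reg \<tau> 1 = k \<and> tables M (arr \<tau>) \<and> (\<forall>a i. a = 4 \<or> a \<in> range good_a \<longrightarrow> arr \<tau> a i = 0)"
proof -
  let ?A = "arr (input G ps)"
  let ?t = "22 * (n + 2)"
  \<comment> \<open>All other arrays keep their input values. In particular, cell 0 of the next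
    digit table is zero, where the accumulation of multiples starts.\<close>
  define ext where "ext q \<tau> \<longleftrightarrow> reg \<tau> 0 = n \<and> reg \<tau> 1 = k \<and>
    (\<forall>a. a \<noteq> 3 \<longrightarrow> a \<notin> digit_a ` {..q} \<longrightarrow> arr \<tau> a = ?A a) \<and> (\<forall>v\<le>n. arr \<tau> 3 v = v * n) \<and>
    (\<forall>i\<le>q. \<forall>v\<le>Suc n. arr \<tau> (digit_a i) v = v * (n + 1) ^ i)" for q and \<tau> :: store
  have inj: "digit_a i = digit_a j \<longleftrightarrow> i = j" "digit_a i \<noteq> 3" for i j
    by (auto simp: digit_a_def)
  have zeroA: "?A a i = 0" if "2 < a" for a i using that by (simp add: input_def Let_def)
  have dig: "2 < digit_a i" for i by (simp add: digit_a_def)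
  have regs: "reg (input G ps) 0 = n" "reg (input G ps) 1 = k" by (simp_all add: input_def Let_def)
  obtain \<tau>1 where \<tau>1: "runs ?t (multiples_c 3 (Reg 0)) (input G ps) \<tau>1" "reg \<tau>1 0 = n" "reg \<tau>1 1 = k"
      "\<forall>b. b \<noteq> 3 \<longrightarrow> arr \<tau>1 b = ?A b" "\<forall>v\<le>Suc n. arr \<tau>1 3 v = v * n"
    using multiples_table[of "input G ps" 3 "Reg 0" n] regs zeroA by auto
  obtain \<tau>2 where \<tau>2: "runs ?t (multiples_c (digit_a 0) (Const 1)) \<tau>1 \<tau>2" "reg \<tau>2 0 = n" "reg \<tau>2 1 = k"
      "\<forall>b. b \<noteq> digit_a 0 \<longrightarrow> arr \<tau>2 b = arr \<tau>1 b" "\<forall>v\<le>Suc n. arr \<tau>2 (digit_a 0) v = v * 1"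
    using multiples_table[of \<tau>1 "digit_a 0" "Const 1" 1] \<tau>1 zeroA[OF dig] inj by auto
  have ext0: "ext 0 \<tau>2"
    using \<tau>1 \<tau>2 inj by (simp add: ext_def)
  let ?s = "\<lambda>i. multiples_c (digit_a (Suc i)) (Read (digit_a i) (Add (Reg 0) (Const 1)))"
  have seq: "\<exists>\<tau>. runs (l * (?t + 1) + 1) (seq_c (map ?s [q..<q + l])) \<sigma> \<tau> \<and> ext (q + l) \<tau>" if "ext q \<sigma>" for q l \<sigma>
    using that
  proof (induction l arbitrary: q \<sigma>)
    case 0
    then show ?case using runs_Skip[of \<sigma>] by auto
  next
    case (Suc l)
    have r0: "reg \<sigma> 0 = n" and D: "arr \<sigma> (digit_a q) (Suc n) = Suc n * (n + 1) ^ q"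
      using Suc.prems by (auto simp: ext_def)
    have "digit_a (Suc q) \<notin> digit_a ` {..q}" using inj(1) by auto
    then have "arr \<sigma> (digit_a (Suc q)) = ?A (digit_a (Suc q))"
      using Suc.prems inj(2) unfolding ext_def by blast
    then have z: "arr \<sigma> (digit_a (Suc q)) 0 = 0" using zeroA[OF dig] by simp
    obtain \<tau> where \<tau>: "runs ?t (?s q) \<sigma> \<tau>" "reg \<tau> 0 = n" "reg \<tau> 1 = reg \<sigma> 1"
      "\<forall>b. b \<noteq> digit_a (Suc q) \<longrightarrow> arr \<tau> b = arr \<sigma> b" "\<forall>v\<le>Suc n. arr \<tau> (digit_a (Suc q)) v = v * (n + 1) ^ Suc q"
      using multiples_table[OF r0 z, of "Read (digit_a q) (Add (Reg 0) (Const 1))" "(n + 1) ^ Suc q"] D inj by auto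
    have "ext (Suc q) \<tau>"
      using Suc.prems \<tau> inj unfolding ext_def by (auto simp: le_Suc_eq atMost_Suc)
    from Suc.IH[OF this] obtain \<rho> where \<rho>: "runs (l * (?t + 1) + 1) (seq_c (map ?s [Suc q..<Suc q + l])) \<tau> \<rho>"
      "ext (Suc q + l) \<rho>" by blast
    have "map ?s [q..<q + Suc l] = ?s q # map ?s [Suc q..<Suc q + l]" by (subst upt_conv_Cons) simp_all
    then have "runs (?t + (l * (?t + 1) + 1) + 1) (seq_c (map ?s [q..<q + Suc l])) \<sigma> \<rho>"
      using runs_Seq[OF \<tau>(1) \<rho>(1)] by simp
    then have "runs (Suc l * (?t + 1) + 1) (seq_c (map ?s [q..<q + Suc l])) \<sigma> \<rho>"
      by (rule runs_mono) simp
    then show ?case using \<rho>(2) by auto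
  qed
  obtain \<tau> where \<tau>: "runs (M * (?t + 1) + 1) (seq_c (map ?s [0..<M])) \<tau>2 \<tau>" "ext M \<tau>"
    using seq[OF ext0, of M] by auto
  have "runs ((M + 2) * (?t + 1) + 1) (init_c M) (input G ps) \<tau>"
    unfolding init_c_def by (rule runs_mono[OF runs_Seq[OF \<tau>1(1) runs_Seq[OF \<tau>2(1) \<tau>(1)]]]) simp
  moreover have "tables M (arr \<tau>)"
  proof -
    have A: "arr \<tau> a = ?A a" if "a \<le> 2" for a
    proof -
      have "a \<notin> digit_a ` {..M}" "a \<noteq> 3" using that by (auto simp: digit_a_def)
      then show ?thesis using \<tau>(2) unfolding ext_def by blast
    qed
    have adj: "?A 0 (u * n + v) \<noteq> 0 \<longleftrightarrow> (u, v) \<in> parcs G" if "u < n" "v < n" for u v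
    proof -
      have "u * n + v < Suc u * n" using that by simp
      also have "\<dots> \<le> n * n" using that by (intro mult_le_mono1) simp
      finally have "u * n + v < n * n" .
      moreover have "n \<noteq> 0" using that by linarith
      then have "(u * n + v) div n = u" "(u * n + v) mod n = v"
        using that(2) div_mult_self3[of n u v] by (simp_all only: mod_mult_self3 div_less mod_less) simp
      ultimately show ?thesis by (simp add: input_def Let_def)
    qed
    then show ?thesis
      unfolding tables_def using \<tau>(2) A[of 0] A[of 1] A[of 2]
      by (simp add: ext_def) (simp add: input_def Let_def)
  qed
  moreover have "arr \<tau> a i = 0" if "a = 4 \<or> a \<in> range good_a" for a i
  proof -
    have "a \<noteq> 3" "a \<notin> digit_a ` {..M}" "2 < a"
      using that by (auto simp: digit_a_def good_a_def) presburger+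
    then show ?thesis using \<tau>(2) zeroA unfolding ext_def by metis
  qed
  ultimately show ?thesis using \<tau>(2) unfolding ext_def by blast
qed

definition found :: "nat \<Rightarrow> nat \<Rightarrow> bool" where
  "found d m \<longleftrightarrow> (\<exists>js. length js = m \<and> distinct js \<and> set js \<subseteq> {..<k} \<and>
     winning (m - d) (map fst (select ps js)) (map snd (select ps js)))"

text \<open>Every \<open>m\<close> has its own array, so the table of a later stage is still blank
  when that stage begins. The condition \<open>2 \<le> m\<close> keeps the reachability table, which
  is that of one pebble, from being overwritten.\<close>

lemma stages_run:
  assumes "distinct ms" "\<And>m. m \<in> set ms \<Longrightarrow> 2 \<le> m \<and> 2 * m \<le> M"
    and "tables M (arr \<sigma>)" "correct 1 1 (arr \<sigma>)" "reg \<sigma> 0 = n" "reg \<sigma> 1 = k"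
    and "\<And>m i. m \<in> set ms \<Longrightarrow> arr \<sigma> (good_a m) i = 0"
  shows "\<exists>\<tau>. runs ((\<Sum>m\<leftarrow>ms. game_const m (m - d) + search_const m + 2) * (n + 2) ^ (M + 2) + 1)
      (seq_c (map (\<lambda>m. Seq (game_c m (m - d)) (search_c m)) ms)) \<sigma> \<tau> \<and>
    reg \<tau> 0 = n \<and> arr \<tau> 4 0 = arr \<sigma> 4 0 \<and> (arr \<tau> 4 1 \<noteq> 0 \<longleftrightarrow> arr \<sigma> 4 1 \<noteq> 0 \<or> (\<exists>m\<in>set ms. found d m))"
  using assms
proof (induction ms arbitrary: \<sigma>)
  case Nil
  then show ?case using runs_Skip[of \<sigma>] by (intro exI[of _ \<sigma>]) simp
next
  case (Cons m ms)
  let ?N = "(n + 2) ^ (M + 2)"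
  have m: "2 \<le> m" "2 * m \<le> M" "1 \<le> m" using Cons.prems(2)[of m] by auto
  obtain \<tau>1 where \<tau>1: "runs (game_const m (m - d) * (n + 2) ^ (2 * m + 2)) (game_c m (m - d)) \<sigma> \<tau>1"
    "reg \<tau>1 0 = n" "reg \<tau>1 1 = k" "\<forall>a. a \<noteq> good_a m \<longrightarrow> arr \<tau>1 a = arr \<sigma> a" "correct m (m - d) (arr \<tau>1)"
    using game_runs[OF Cons.prems(3) m(2,3) disjI2[OF Cons.prems(4)] Cons.prems(5), of "m - d"] Cons.prems(5-7) by auto
  have tab1: "tables M (arr \<tau>1)" using tables_good_a[OF Cons.prems(3)] \<tau>1(4) by blast
  obtain \<tau>2 where \<tau>2: "runs (search_const m * (n + 2) ^ (2 * m)) (search_c m) \<tau>1 \<tau>2"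
    "reg \<tau>2 0 = n" "reg \<tau>2 1 = k" "\<forall>a. a \<noteq> 4 \<longrightarrow> arr \<tau>2 a = arr \<tau>1 a" "arr \<tau>2 4 0 = arr \<tau>1 4 0"
    "arr \<tau>2 4 1 \<noteq> 0 \<longleftrightarrow> arr \<tau>1 4 1 \<noteq> 0 \<or> found d m"
    using search_runs[OF tab1 m(2) \<tau>1(5,2,3)] unfolding found_def by blast
  have four: "arr \<tau>1 4 = arr \<sigma> 4" using \<tau>1(4) good_a_neq(5)[of m] by metis
  have good: "arr \<tau>2 (good_a m') = arr \<sigma> (good_a m')" if "m' \<noteq> m" for m'
    using \<tau>1(4) \<tau>2(4) good_a_neq(5)[of m'] good_a_inj[of m' m] that by metis
  have "\<exists>\<tau>. runs ((\<Sum>m\<leftarrow>ms. game_const m (m - d) + search_const m + 2) * ?N + 1)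
      (seq_c (map (\<lambda>m. Seq (game_c m (m - d)) (search_c m)) ms)) \<tau>2 \<tau> \<and>
    reg \<tau> 0 = n \<and> arr \<tau> 4 0 = arr \<tau>2 4 0 \<and> (arr \<tau> 4 1 \<noteq> 0 \<longleftrightarrow> arr \<tau>2 4 1 \<noteq> 0 \<or> (\<exists>m\<in>set ms. found d m))"
  proof (rule Cons.IH)
    show "tables M (arr \<tau>2)" using tables_flags[OF tab1] \<tau>2(4) by blast
    show "correct 1 1 (arr \<tau>2)"
      using Cons.prems(4) correct_cong[of "arr \<tau>2" 1 "arr \<sigma>" 1] good[of 1] m by simp
    show "arr \<tau>2 (good_a m') i = 0" if "m' \<in> set ms" for m' i
    proof -
      have "m' \<noteq> m" using that Cons.prems(1) by auto
      with good[of m'] Cons.prems(7)[of m'] that show ?thesis by simp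
    qed
  qed (use Cons.prems(1,2) \<tau>2 in auto)
  then obtain \<tau> where \<tau>: "runs ((\<Sum>m\<leftarrow>ms. game_const m (m - d) + search_const m + 2) * ?N + 1)
      (seq_c (map (\<lambda>m. Seq (game_c m (m - d)) (search_c m)) ms)) \<tau>2 \<tau>"
    "reg \<tau> 0 = n" "arr \<tau> 4 0 = arr \<tau>2 4 0" "arr \<tau> 4 1 \<noteq> 0 \<longleftrightarrow> arr \<tau>2 4 1 \<noteq> 0 \<or> (\<exists>m\<in>set ms. found d m)"
    by blast
  let ?S = "\<Sum>m\<leftarrow>ms. game_const m (m - d) + search_const m + 2"
  have "game_const m (m - d) * (n + 2) ^ (2 * m + 2) \<le> game_const m (m - d) * ?N"
    "search_const m * (n + 2) ^ (2 * m) \<le> search_const m * ?N" "1 \<le> ?N"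
    using m by (intro mult_le_mono2 power_increasing one_le_power; simp)+
  then have "game_const m (m - d) * (n + 2) ^ (2 * m + 2) + search_const m * (n + 2) ^ (2 * m) + 1 + (?S * ?N + 1) + 1
      \<le> (game_const m (m - d) + search_const m + 2 + ?S) * ?N + 1"
    unfolding add_mult_distrib by linarith
  then have "runs ((\<Sum>m\<leftarrow>m # ms. game_const m (m - d) + search_const m + 2) * ?N + 1)
      (seq_c (map (\<lambda>m. Seq (game_c m (m - d)) (search_c m)) (m # ms))) \<sigma> \<tau>"
    using runs_mono[OF runs_Seq[OF runs_Seq[OF \<tau>1(1) \<tau>2(1)] \<tau>(1)]] by simp
  then show ?case using \<tau>(2-4) \<tau>2(5,6) four by (intro exI[of _ \<tau>]) auto
qed

text \<open>Without vertices there are no pairs, and the negative bound restricts nothing, so the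
  answer is yes. The search could not find this out, as there are no indices to choose.\<close>

lemma routing_correct:
  assumes "1 \<le> d"
  shows "has_routing (with_proj G) (int k - int d) (set ps) \<longleftrightarrow>
    n = 0 \<or> (\<forall>(s, t)\<in>set ps. winning 1 [s] [t]) \<and> (\<exists>m\<in>{d<..3 * d}. found d m)"
proof (cases "n = 0")
  case True
  then have V: "pverts G = {}" using verts by simp
  then have "set ps = {}" using inst by (auto simp: acyclic_instance_def)
  then have "is_routing (with_proj G) (int k - int d) (set ps) undefined" using V by (simp add: is_routing_def)
  then show ?thesis using True by (auto simp: has_routing_def)
next
  case False
  then have "pverts G \<noteq> {}" by auto
  then show ?thesis
    using routing_by_winning[OF _ _ _ assms, of ps] inst False unfolding found_def acyclic_instance_def by blast
qed

lemma routing_runs: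
  assumes d: "1 \<le> d"
  shows "\<exists>\<tau>. runs (total_const d * (n + 2) ^ (6 * d + 2)) (routing_c d) (input G ps) \<tau> \<and>
    (accepting \<tau> \<longleftrightarrow> has_routing (with_proj G) (int k - int d) (set ps))"
proof -
  let ?M = "6 * d"
  let ?N = "(n + 2) ^ (?M + 2)"
  let ?ms = "[Suc d..<Suc (3 * d)]"
  let ?S = "\<Sum>m\<leftarrow>?ms. game_const m (m - d) + search_const m + 2"
  obtain \<tau>1 where \<tau>1: "runs ((?M + 2) * (22 * (n + 2) + 1) + 1) (init_c ?M) (input G ps) \<tau>1"
    "reg \<tau>1 0 = n" "reg \<tau>1 1 = k" "tables ?M (arr \<tau>1)" "\<And>a i. a = 4 \<or> a \<in> range good_a \<Longrightarrow> arr \<tau>1 a i = 0"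
    using init_runs[of ?M] by blast
  have M: "2 * 1 \<le> ?M" "2 \<le> ?M" using d by auto
  obtain \<tau>2 where \<tau>2: "runs (game_const 1 1 * (n + 2) ^ (2 * 1 + 2)) (game_c 1 1) \<tau>1 \<tau>2"
    "reg \<tau>2 0 = n" "reg \<tau>2 1 = k" "\<forall>a. a \<noteq> good_a 1 \<longrightarrow> arr \<tau>2 a = arr \<tau>1 a" "correct 1 1 (arr \<tau>2)"
    using game_runs[OF \<tau>1(4) M(1) order_refl disjI1[OF refl] \<tau>1(2), of 1] \<tau>1(2,3,5) by auto
  have tab2: "tables ?M (arr \<tau>2)" using tables_good_a[OF \<tau>1(4)] \<tau>2(4) by blast
  have four2: "arr \<tau>2 4 i = 0" for i using \<tau>2(4) \<tau>1(5)[of 4 i] good_a_neq(5)[of 1] by metis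
  obtain \<tau>3 where \<tau>3: "runs ((cost unlinked_e + 13) * (n + 2) ^ 2) link_c \<tau>2 \<tau>3"
    "reg \<tau>3 0 = n" "reg \<tau>3 1 = k" "\<forall>a. a \<noteq> 4 \<longrightarrow> arr \<tau>3 a = arr \<tau>2 a" "arr \<tau>3 4 1 = arr \<tau>2 4 1"
    "arr \<tau>3 4 0 = 0 \<longleftrightarrow> (\<forall>(s, t)\<in>set ps. winning 1 [s] [t])"
    using link_runs[OF tab2 M(2) \<tau>2(5,2,3) four2] by (elim exE conjE) (rule that)
  have tab3: "tables ?M (arr \<tau>3)" using tables_flags[OF tab2] \<tau>3(4) by blast
  have same: "arr \<tau>3 (good_a m) = arr \<tau>2 (good_a m)" for m using \<tau>3(4) good_a_neq(5) by blast
  have corr3: "correct 1 1 (arr \<tau>3)" using \<tau>2(5) unfolding correct_cong[of "arr \<tau>3" 1 "arr \<tau>2" 1, OF same] .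
  have good3: "arr \<tau>3 (good_a m) i = 0" if "m \<in> set ?ms" for m i
  proof -
    have "d < m" using that by (simp del: upt_Suc)
    then have "m \<noteq> 1" using d by linarith
    then have "good_a m \<noteq> good_a 1" unfolding good_a_inj .
    then have "arr \<tau>2 (good_a m) = arr \<tau>1 (good_a m)" using \<tau>2(4) by blast
    then show ?thesis unfolding same using \<tau>1(5)[of "good_a m" i] by simp
  qed
  have ms: "distinct ?ms" "\<And>m. m \<in> set ?ms \<Longrightarrow> 2 \<le> m \<and> 2 * m \<le> ?M" using d by auto
  have "\<exists>\<tau>. runs (?S * ?N + 1) (seq_c (map (\<lambda>m. Seq (game_c m (m - d)) (search_c m)) ?ms)) \<tau>3 \<tau> \<and>
      reg \<tau> 0 = n \<and> arr \<tau> 4 0 = arr \<tau>3 4 0 \<and> (arr \<tau> 4 1 \<noteq> 0 \<longleftrightarrow> arr \<tau>3 4 1 \<noteq> 0 \<or> (\<exists>m\<in>set ?ms. found d m))"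
    by (rule stages_run) (fact ms tab3 corr3 \<tau>3 good3)+
  then obtain \<tau>4 where \<tau>4: "runs (?S * ?N + 1) (seq_c (map (\<lambda>m. Seq (game_c m (m - d)) (search_c m)) ?ms)) \<tau>3 \<tau>4"
    "reg \<tau>4 0 = n" "arr \<tau>4 4 0 = arr \<tau>3 4 0" "arr \<tau>4 4 1 \<noteq> 0 \<longleftrightarrow> arr \<tau>3 4 1 \<noteq> 0 \<or> (\<exists>m\<in>set ?ms. found d m)"
    by (elim exE conjE) (rule that)
  let ?e = "Add (eq_e (Reg 0) (Const 0)) (and_e (not_e (Read 4 (Const 0))) (Read 4 (Const 1)))"
  let ?\<tau> = "set_reg 0 (val ?e \<tau>4) \<tau>4"
  have "cost ?e \<le> 30" by (simp add: eq_e_def and_e_def not_e_def)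
  then have last: "runs 31 (Assign 0 ?e) \<tau>4 ?\<tau>"
    using runs_mono[OF runs_Assign[of ?e 0 \<tau>4]] by simp
  have N: "1 \<le> ?N" "n + 2 \<le> ?N" "(n + 2) ^ 2 \<le> ?N" "(n + 2) ^ (2 * 1 + 2) \<le> ?N"
    using power_increasing[of 1 "?M + 2" "n + 2"] power_increasing[of 2 "?M + 2" "n + 2"]
      power_increasing[of "2 * 1 + 2" "?M + 2" "n + 2"] d by simp_all
  have "runs (total_const d * ?N) (routing_c d) (input G ps) ?\<tau>"
    unfolding routing_c_def
  proof (rule runs_mono[OF runs_Seq[OF \<tau>1(1) runs_Seq[OF \<tau>2(1) runs_Seq[OF \<tau>3(1) runs_Seq[OF \<tau>4(1) last]]]]])
    have "22 * a + 1 \<le> 23 * b" if "1 \<le> b" "a \<le> b" for a b :: nat using that by linarith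
    from this[OF N(1,2)] have "(?M + 2) * (22 * (n + 2) + 1) \<le> (?M + 2) * (23 * ?N)"
      by (rule mult_le_mono2)
    moreover have "game_const 1 1 * (n + 2) ^ (2 * 1 + 2) \<le> game_const 1 1 * ?N" using N by (intro mult_le_mono2)
    moreover have "(cost unlinked_e + 13) * (n + 2) ^ 2 \<le> (cost unlinked_e + 13) * ?N" using N by (intro mult_le_mono2)
    moreover have "total_const d * ?N = (?M + 2) * (23 * ?N) + game_const 1 1 * ?N + (cost unlinked_e + 13) * ?N +
        ?S * ?N + 40 * ?N"
      unfolding total_const_def add_mult_distrib by (simp only: mult.assoc)
    ultimately show "(?M + 2) * (22 * (n + 2) + 1) + 1 + (game_const 1 1 * (n + 2) ^ (2 * 1 + 2) +
        ((cost unlinked_e + 13) * (n + 2) ^ 2 + (?S * ?N + 1 + 31 + 1) + 1) + 1) + 1 \<le> total_const d * ?N"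
      using N(1) by linarith
  qed
  moreover have "accepting ?\<tau> \<longleftrightarrow> has_routing (with_proj G) (int k - int d) (set ps)"
  proof -
    have "accepting ?\<tau> \<longleftrightarrow> n = 0 \<or> arr \<tau>4 4 0 = 0 \<and> arr \<tau>4 4 1 \<noteq> 0"
      using \<tau>4(2) by (simp add: accepting_def)
    also have "\<dots> \<longleftrightarrow> n = 0 \<or> (\<forall>(s, t)\<in>set ps. winning 1 [s] [t]) \<and> (\<exists>m\<in>set ?ms. found d m)"
      unfolding \<tau>4(3,4) \<tau>3(5,6) four2 by blast
    also have "set ?ms = {d<..3 * d}" by auto
    finally show ?thesis unfolding routing_correct[OF d] .
  qed
  ultimately show ?thesis by blast
qed

end

theorem theorem2:
  shows "\<exists>C :: nat \<Rightarrow> nat.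
    (\<lambda>d. real (C d)) \<in> O(\<lambda>d. real d) \<and>
    (\<forall>d \<ge> 1. \<exists>(p :: com) (T :: nat \<Rightarrow> nat).
       decides_routing_within d p T \<and> (\<lambda>n. real (T n)) \<in> O(\<lambda>n. real n ^ C d))"
proof (intro exI conjI allI impI)
  \<comment> \<open>For \<open>d \<ge> 1\<close> one has
    \<open>6 * d + 2 \<le> 8 * d\<close>.\<close>
  show "(\<lambda>d. real (6 * d + 2)) \<in> O(\<lambda>d. real d)"
    by (rule bigoI[of _ 8], rule eventually_sequentiallyI[of 1]) simp
  fix d :: nat assume d: "1 \<le> d"
  show "decides_routing_within d (routing_c d) (\<lambda>n. total_const d * (n + 2) ^ (6 * d + 2))"
    unfolding decides_routing_within_def
  proof (intro allI impI)
    fix G ps assume "acyclic_instance G ps"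
    then interpret routing_instance G ps by unfold_locales
    show "\<exists>m \<tau>. exec (routing_c d) (input G ps) m \<tau> \<and>
        m \<le> total_const d * (card (pverts G) + 2) ^ (6 * d + 2) \<and>
        (accepting \<tau> \<longleftrightarrow> has_routing (with_proj G) (int (length ps) - int d) (set ps))"
      using routing_runs[OF d] unfolding runs_def by blast
  qed
  show "(\<lambda>n. real (total_const d * (n + 2) ^ (6 * d + 2))) \<in> O(\<lambda>n. real n ^ (6 * d + 2))"
  \<comment> \<open>The base \<open>n + 2\<close> keeps the time bound valid for
    \<open>n = 0\<close>; for \<open>n \<ge> 1\<close> it is at most \<open>3 * n\<close>, whence
    the power of 3.\<close>
  proof (rule bigoI[of _ "real (total_const d) * 3 ^ (6 * d + 2)"], rule eventually_sequentiallyI[of 1])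
    fix n :: nat assume "1 \<le> n"
    then have "real (n + 2) ^ (6 * d + 2) \<le> (3 * real n) ^ (6 * d + 2)" by (intro power_mono) auto
    then have "real (total_const d) * real (n + 2) ^ (6 * d + 2) \<le>
        real (total_const d) * (3 ^ (6 * d + 2) * real n ^ (6 * d + 2))"
      unfolding power_mult_distrib by (rule mult_left_mono) simp
    then show "norm (real (total_const d * (n + 2) ^ (6 * d + 2))) \<le>
        real (total_const d) * 3 ^ (6 * d + 2) * norm (real n ^ (6 * d + 2))"
      by (simp only: of_nat_mult of_nat_power norm_mult norm_power real_norm_def abs_mult power_abs abs_of_nat mult.assoc)
  qed
qed

end
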